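(* Let $m\ge1$. The union (as an indexed family) of the three dyadic tube Haar systems $\mathcal{B}_1\cup\mathcal{B}_2\cup\mathcal{B}_3$ forms a tight frame for $L^2(\mathbb{R}^{2m})$ with frame bound $3$, i.e. $\sum_{i=1}^3\sum_{R\in\mathscr R^{(i)}}\sum_{\vec\epsilon\in\mathcal E\times\mathcal E}|\langle f,h_R^{\vec\epsilon}\rangle|^2=3\|f\|_{L^2}^2$ for all $f\in L^2(\mathbb R^{2m})$. Consequently, for any $f\in L^2(\mathbb{R}^{2m})$, $$f=\frac13\sum_{i=1}^3\ \sum_{R\in\mathscr R^{(i)}}\ \sum_{\vec\epsilon\in\mathcal E\times\mathcal E}\langle f,h_R^{\vec\epsilon}\rangle\,h_R^{\vec\epsilon},$$ where the sum converges unconditionally in $L^2(\mathbb{R}^{2m})$.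
   Context: $\mathscr{D}$ is the collection of all standard (half-open) dyadic cubes in $\mathbb{R}^m$. For $I=I_1\times\cdots\times I_m\in\mathscr{D}$, $\{h_I^\epsilon\}_{\epsilon\in\mathcal{E}}$, $\mathcal{E}=\{1,\dots,2^m-1\}$, is the standard $L^2$-normalized Haar wavelet basis supported on $I$: the functions $\bigotimes_{i=1}^m h_{I_i}^{a_i}$ with $a\in\{0,1\}^m\setminus\{0\}$, where $h_{K}^0=|K|^{-1/2}\chi_K$ and $h_K^1=|K|^{-1/2}(\chi_{K_{\rm left}}-\chi_{K_{\rm right}})$ for a dyadic interval $K$, enumerated by $\mathcal E$. Points of $\mathbb R^{2m}$ are written $(x_1,x_2)$ with $x_1,x_2\in\mathbb R^m$. For $I,J\in\mathscr{D}$ and $\vec\epsilon=(\epsilon_1,\epsilon_2)\in\mathcal{E}\times\mathcal{E}$, $h_{I\times J}^{\vec\epsilon}(x_1,x_2)=h_I^{\epsilon_1}(x_1)h_J^{\epsilon_2}(x_2)$. Let $T_2(x_1,x_2)=(x_1-x_2,x_2)$, $T_3(x_1,x_2)=(x_1,x_2-x_1)$, $I\times_t J=T_2^{-1}(I\times J)$, $I\,{}_t\!\times J=T_3^{-1}(I\times J)$, and $h_{I\times_t J}^{\vec\epsilon}=h_{I\times J}^{\vec\epsilon}\circ T_2$, $h_{I\,{}_t\!\times J}^{\vec\epsilon}=h_{I\times J}^{\vec\epsilon}\circ T_3$. $\mathscr R^{(1)}=\{I\times J\}$, $\mathscr R^{(2)}=\{I\times_t J\}$, $\mathscr R^{(3)}=\{I\,{}_t\!\times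 J\}$ with $I,J$ ranging over $\mathscr D$, and $\mathcal B_i=\{h_R^{\vec\epsilon}:R\in\mathscr R^{(i)},\ \vec\epsilon\in\mathcal E\times\mathcal E\}$ for $i=1,2,3$. *)

theory Defs
  imports "HOL-Analysis.Analysis"
begin

text \<open>
  \<^bold>\<open>R\<close>^m is \<^typ>\<open>real ^ 'n\<close> with m = CARD('n), and \<^bold>\<open>R\<close>^(2m) is the product
  \<^typ>\<open>(real ^ 'n) \<times> (real ^ 'n)\<close>, so that its points are literally pairs (x1, x2).
\<close>

section \<open>Square-integrable functions, tight frames, unconditional sums\<close>

text \<open>
  Elements of L2 are represented by functions, not by classes modulo null sets; equality in L2
  is therefore equality almost everywhere.
\<close>

definition L2 :: "'a measure \<Rightarrow> ('a \<Rightarrow> complex) set" where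
  "L2 M = {f \<in> borel_measurable M. integrable M (\<lambda>x. (cmod (f x))\<^sup>2)}"

definition L2_inner :: "'a measure \<Rightarrow> ('a \<Rightarrow> complex) \<Rightarrow> ('a \<Rightarrow> complex) \<Rightarrow> complex" where
  "L2_inner M f g = (LINT x|M. f x * cnj (g x))"

definition L2_norm :: "'a measure \<Rightarrow> ('a \<Rightarrow> complex) \<Rightarrow> real" where
  "L2_norm M f = sqrt (LINT x|M. (cmod (f x))\<^sup>2)"

definition tight_frame_L2 ::
  "'a measure \<Rightarrow> real \<Rightarrow> 'j set \<Rightarrow> ('j \<Rightarrow> 'a \<Rightarrow> complex) \<Rightarrow> bool" where
  "tight_frame_L2 M A J \<phi> \<longleftrightarrow>
     A > 0 \<and> (\<forall>j\<in>J. \<phi> j \<in> L2 M) \<and>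
     (\<forall>f\<in>L2 M. ((\<lambda>j. (cmod (L2_inner M f (\<phi> j)))\<^sup>2) has_sum A * (L2_norm M f)\<^sup>2) J)"

text \<open>
  Unconditional convergence in L2 norm, i.e. convergence of the net of finite partial sums; this
  is \<^const>\<open>has_sum\<close> with respect to the seminorm \<^const>\<open>L2_norm\<close>.
\<close>

definition L2_has_sum ::
  "'a measure \<Rightarrow> ('j \<Rightarrow> 'a \<Rightarrow> complex) \<Rightarrow> 'j set \<Rightarrow> ('a \<Rightarrow> complex) \<Rightarrow> bool" where
  "L2_has_sum M g J s \<longleftrightarrow>
     (\<forall>j\<in>J. g j \<in> L2 M) \<and> s \<in> L2 M \<and>
     ((\<lambda>F. L2_norm M (\<lambda>x. (\<Sum>j\<in>F. g j x) - s x)) \<longlongrightarrow> 0) (finite_subsets_at_top J)"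

section \<open>Dyadic cubes and Haar functions\<close>

definition dyadic_interval :: "int \<Rightarrow> int \<Rightarrow> real set" where
  "dyadic_interval k j = {of_int j * 2 powi (- k) ..< (of_int j + 1) * 2 powi (- k)}"

definition dyadic_cubes :: "(real ^ 'n) set set" where
  "dyadic_cubes = {{x. \<forall>i. x $ i \<in> dyadic_interval k (j i)} |k j. True}"

text \<open>For a half-open interval K = [a, b), these are [a, (a+b)/2) and [(a+b)/2, b).\<close>

definition left_half :: "real set \<Rightarrow> real set" where
  "left_half K = {x \<in> K. x < (Inf K + Sup K) / 2}"

definition right_half :: "real set \<Rightarrow> real set" where
  "right_half K = {x \<in> K. x \<ge> (Inf K + Sup K) / 2}"

text \<open>The superscripts 0 and 1 are \<^const>\<open>False\<close> and \<^const>\<open>True\<close>.\<close>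

definition haar_interval :: "bool \<Rightarrow> real set \<Rightarrow> real \<Rightarrow> real" where
  "haar_interval b K x =
     (if b then indicator (left_half K) x - indicator (right_half K) x else indicator K x)
       / sqrt (measure lborel K)"

text \<open>The factors I_i of a cube I are its coordinate projections.\<close>

definition haar_cube :: "('n \<Rightarrow> bool) \<Rightarrow> (real ^ 'n) set \<Rightarrow> real ^ 'n \<Rightarrow> real" where
  "haar_cube a I x = (\<Prod>i\<in>UNIV. haar_interval (a i) ((\<lambda>y. y $ i) ` I) (x $ i))"

text \<open>
  The index set {1, ..., 2^m - 1} merely enumerates the nonzero elements of {0,1}^m, which are
  used here as indices directly.
\<close>

definition signatures :: "('n \<Rightarrow> bool) set" where
  "signatures = UNIV - {\<lambda>_. False}"

definition haar_rect ::
  "('n \<Rightarrow> bool) \<times> ('n \<Rightarrow> bool) \<Rightarrow> (real ^ 'n) set \<Rightarrow> (real ^ 'n) set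
     \<Rightarrow> (real ^ 'n) \<times> (real ^ 'n) \<Rightarrow> real" where
  "haar_rect \<epsilon> I J x = haar_cube (fst \<epsilon>) I (fst x) * haar_cube (snd \<epsilon>) J (snd x)"

section \<open>Tubes and tube Haar systems\<close>

text \<open>T_1 is the identity; T_2 and T_3 are the two shears.\<close>

definition shear :: "nat \<Rightarrow> (real ^ 'n) \<times> (real ^ 'n) \<Rightarrow> (real ^ 'n) \<times> (real ^ 'n)" where
  "shear i = (if i = 2 then (\<lambda>(x1, x2). (x1 - x2, x2))
              else if i = 3 then (\<lambda>(x1, x2). (x1, x2 - x1))
              else id)"

definition tubes :: "nat \<Rightarrow> ((real ^ 'n) \<times> (real ^ 'n)) set set" where
  "tubes i = {shear i -` (I \<times> J) |I J. I \<in> dyadic_cubes \<and> J \<in> dyadic_cubes}"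

text \<open>
  A tube R = T_i^(-1)(I \<times> J) determines I and J as the two projections of T_i(R); see
  \<open>haar_tube_eq\<close> below.
\<close>

definition haar_tube ::
  "nat \<Rightarrow> ((real ^ 'n) \<times> (real ^ 'n)) set \<Rightarrow> ('n \<Rightarrow> bool) \<times> ('n \<Rightarrow> bool)
     \<Rightarrow> (real ^ 'n) \<times> (real ^ 'n) \<Rightarrow> complex" where
  "haar_tube i R \<epsilon> x =
     complex_of_real (haar_rect \<epsilon> (fst ` shear i ` R) (snd ` shear i ` R) (shear i x))"

definition tube_indices ::
  "(nat \<times> ((real ^ 'n) \<times> (real ^ 'n)) set \<times> ('n \<Rightarrow> bool) \<times> ('n \<Rightarrow> bool)) set" where
  "tube_indices = (SIGMA i:{1, 2, 3}. tubes i \<times> (signatures \<times> signatures))"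

definition tube_family ::
  "nat \<times> ((real ^ 'n) \<times> (real ^ 'n)) set \<times> ('n \<Rightarrow> bool) \<times> ('n \<Rightarrow> bool)
     \<Rightarrow> (real ^ 'n) \<times> (real ^ 'n) \<Rightarrow> complex" where
  "tube_family = (\<lambda>(i, R, \<epsilon>). haar_tube i R \<epsilon>)"

lemma surj_shear: "surj (shear i)"
proof -
  have "\<exists>x. y = shear i x" for y :: "(real ^ 'n) \<times> (real ^ 'n)"
  proof (cases y)
    case (Pair a b)
    consider "i = 2" | "i = 3" | "i \<noteq> 2" "i \<noteq> 3" by blast
    then show ?thesis
    proof cases
      case 1
      then have "y = shear i (a + b, b)" by (simp add: Pair shear_def)
      then show ?thesis ..
    next
      case 2
      then have "y = shear i (a, b + a)" by (simp add: Pair shear_def)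
      then show ?thesis ..
    next
      case 3
      then have "y = shear i y" by (simp add: shear_def)
      then show ?thesis ..
    qed
  qed
  then show ?thesis by (auto simp: surj_def)
qed

lemma dyadic_cube_nonempty:
  assumes "I \<in> dyadic_cubes"
  shows "I \<noteq> {}"
proof -
  obtain k j where I: "I = {x. \<forall>i. x $ i \<in> dyadic_interval k (j i)}"
    using assms by (auto simp: dyadic_cubes_def)
  have "(\<chi> i. of_int (j i) * 2 powi (- k)) \<in> I"
    by (simp add: I dyadic_interval_def)
  then show ?thesis by blast
qed

lemma haar_tube_eq:
  assumes "I \<in> dyadic_cubes" "J \<in> dyadic_cubes"
  shows "haar_tube i (shear i -` (I \<times> J)) \<epsilon> = (\<lambda>x. complex_of_real (haar_rect \<epsilon> I J (shear i x)))"
  using dyadic_cube_nonempty[OF assms(1)] dyadic_cube_nonempty[OF assms(2)]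
  by (simp add: haar_tube_def surj_image_vimage_eq surj_shear fun_eq_iff)

end

theory Submission
  imports Defs
begin

text \<open>
  Each of the three tube Haar systems is by itself an orthonormal basis of \<open>L\<^sup>2\<close>. So for each of them
  Parseval's identity holds, and the expansion of \<open>f\<close> converges unconditionally to \<open>f\<close>. Adding up the
  three gives frame bound 3 and the sum \<open>3 f\<close>.

  Composition with a shear is unitary, because shears preserve Lebesgue measure (\<open>distr_shear\<close>).
  It carries the first system to the second and third, so everything reduces to the products
  \<open>h_I^a \<otimes> h_J^b\<close>.

  Orthonormality (\<open>haar_cube_orthonormal\<close>) factors into one-dimensional integrals over the coordinates.
  For two different cubes or signatures one factor vanishes. At equal scale, in some coordinate the two
  intervals are disjoint, or they agree and carry \<open>h^0\<close> and \<open>h^1\<close>. At different scales, in some coordinate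
  the shorter interval carries \<open>h^1\<close>, which has mean zero, while the other function is constant there.

  Completeness: by Bessel's inequality the functions that are the sum of their expansion form a closed
  subspace of \<open>L\<^sup>2\<close> (\<open>closed_subspace_expandable\<close>). So it suffices that a closed subspace containing all
  products \<open>h_I^a \<otimes> h_J^b\<close> is everything. A closed subspace that contains the Haar functions of cubes
  contains the indicators of cubes: the indicator of a cube is, up to Haar functions, \<open>2 ^ -m\<close> times that
  of its parent, and iterating this leaves a remainder spread over a huge ancestor, whose norm tends to
  zero (\<open>closed_subspace_dyadic_cubes\<close>). Applied in each of the two variables, this gives the indicators
  of all products of two cubes. As those products generate the Borel sets and are, together with the empty
  set, stable under intersection, Dynkin's theorem and approximation by simple functions give everything
  (\<open>L2_subset_closed_subspace\<close>, \<open>closed_subspace_dyadic_rectangles\<close>).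
\<close>

section \<open>Square-integrable functions\<close>

text \<open>
  The squared norm is used in place of \<^const>\<open>L2_norm\<close>: only convergence of distances to zero matters below, and
  for this the pointwise bound \<open>\<bar>a + b\<bar>\<^sup>2 \<le> 2 \<bar>a\<bar>\<^sup>2 + 2 \<bar>b\<bar>\<^sup>2\<close> serves as triangle inequality.
\<close>

definition L2_sq :: "'a measure \<Rightarrow> ('a \<Rightarrow> complex) \<Rightarrow> real" where
  "L2_sq M f = (LINT x|M. (cmod (f x))\<^sup>2)"

lemma L2_sq_nonneg: "0 \<le> L2_sq M f"
  by (simp add: L2_sq_def)

lemma L2_norm_eq: "L2_norm M f = sqrt (L2_sq M f)"
  by (simp add: L2_norm_def L2_sq_def)

lemma L2_norm_sq: "(L2_norm M f)\<^sup>2 = L2_sq M f"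
  by (simp add: L2_norm_eq L2_sq_nonneg)

lemma L2_sq_minus_commute: "L2_sq M (\<lambda>x. f x - g x) = L2_sq M (\<lambda>x. g x - f x)"
  by (simp add: L2_sq_def norm_minus_commute)

lemma L2_measurable: "f \<in> L2 M \<Longrightarrow> f \<in> borel_measurable M"
  by (simp add: L2_def)

lemma L2_integrable_sq: "f \<in> L2 M \<Longrightarrow> integrable M (\<lambda>x. (cmod (f x))\<^sup>2)"
  by (simp add: L2_def)

lemma cmod_add_sq_le: "(cmod (a + b))\<^sup>2 \<le> 2 * (cmod a)\<^sup>2 + 2 * (cmod b)\<^sup>2"
proof -
  have "(cmod (a + b))\<^sup>2 \<le> (cmod a + cmod b)\<^sup>2"
    by (intro power_mono norm_triangle_ineq) simp
  also have "\<dots> \<le> 2 * (cmod a)\<^sup>2 + 2 * (cmod b)\<^sup>2"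
    using zero_le_power2[of "cmod a - cmod b"] by (simp add: power2_eq_square algebra_simps)
  finally show ?thesis .
qed

lemma L2_zero: "(\<lambda>x. 0) \<in> L2 M"
  by (simp add: L2_def)

lemma L2_add:
  assumes "f \<in> L2 M" "g \<in> L2 M"
  shows "(\<lambda>x. f x + g x) \<in> L2 M"
proof -
  note [measurable] = assms[THEN L2_measurable]
  have "integrable M (\<lambda>x. 2 * (cmod (f x))\<^sup>2 + 2 * (cmod (g x))\<^sup>2)"
    using assms by (simp add: L2_integrable_sq)
  then have "integrable M (\<lambda>x. (cmod (f x + g x))\<^sup>2)"
    by (rule Bochner_Integration.integrable_bound) (auto simp: cmod_add_sq_le)
  then show ?thesis by (simp add: L2_def)
qed

lemma L2_scale:
  assumes "f \<in> L2 M"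
  shows "(\<lambda>x. c * f x) \<in> L2 M"
  using assms by (auto simp: L2_def norm_mult power_mult_distrib)

lemma L2_diff:
  assumes "f \<in> L2 M" "g \<in> L2 M"
  shows "(\<lambda>x. f x - g x) \<in> L2 M"
  using L2_add[OF assms(1) L2_scale[OF assms(2), of "-1"]] by simp

lemma L2_sum:
  assumes "\<And>j. j \<in> F \<Longrightarrow> g j \<in> L2 M"
  shows "(\<lambda>x. \<Sum>j\<in>F. g j x) \<in> L2 M"
  using assms by (induction F rule: infinite_finite_induct) (auto intro: L2_zero L2_add)

lemma L2_sq_add_le:
  assumes "f \<in> L2 M" "g \<in> L2 M"
  shows "L2_sq M (\<lambda>x. f x + g x) \<le> 2 * L2_sq M f + 2 * L2_sq M g"
proof -
  have "L2_sq M (\<lambda>x. f x + g x) \<le> (LINT x|M. 2 * (cmod (f x))\<^sup>2 + 2 * (cmod (g x))\<^sup>2)"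
    unfolding L2_sq_def using assms
    by (intro integral_mono cmod_add_sq_le L2_integrable_sq L2_add) (auto simp: L2_integrable_sq)
  also have "\<dots> = 2 * L2_sq M f + 2 * L2_sq M g"
    using assms by (simp add: L2_sq_def L2_integrable_sq)
  finally show ?thesis .
qed

lemma L2_sq_scale: "L2_sq M (\<lambda>x. c * f x) = (cmod c)\<^sup>2 * L2_sq M f"
  by (simp add: L2_sq_def norm_mult power_mult_distrib)

lemma integrable_L2_inner:
  assumes "f \<in> L2 M" "g \<in> L2 M"
  shows "integrable M (\<lambda>x. f x * cnj (g x))"
proof -
  note [measurable] = assms[THEN L2_measurable]
  have "(cnj :: complex \<Rightarrow> complex) \<in> borel_measurable borel"
    by (intro borel_measurable_continuous_onI continuous_intros)
  then have [measurable]: "(\<lambda>x. cnj (g x)) \<in> borel_measurable M"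
    by measurable
  have *: "cmod a * cmod b \<le> (cmod a)\<^sup>2 + (cmod b)\<^sup>2" for a b
  proof -
    have "2 * (cmod a * cmod b) \<le> (cmod a)\<^sup>2 + (cmod b)\<^sup>2"
      using zero_le_power2[of "cmod a - cmod b"] by (simp add: power2_eq_square algebra_simps)
    moreover have "0 \<le> cmod a * cmod b" by simp
    ultimately show ?thesis by linarith
  qed
  have "integrable M (\<lambda>x. (cmod (f x))\<^sup>2 + (cmod (g x))\<^sup>2)"
    using assms by (simp add: L2_integrable_sq)
  then show ?thesis
    by (rule Bochner_Integration.integrable_bound) (auto simp: norm_mult *)
qed

lemma L2_inner_add_left:
  assumes "f \<in> L2 M" "g \<in> L2 M" "h \<in> L2 M"
  shows "L2_inner M (\<lambda>x. f x + g x) h = L2_inner M f h + L2_inner M g h"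
  using assms by (simp add: L2_inner_def ring_distribs integrable_L2_inner)

lemma L2_inner_diff_left:
  assumes "f \<in> L2 M" "g \<in> L2 M" "h \<in> L2 M"
  shows "L2_inner M (\<lambda>x. f x - g x) h = L2_inner M f h - L2_inner M g h"
  using assms by (simp add: L2_inner_def ring_distribs integrable_L2_inner)

lemma L2_inner_scale_left: "L2_inner M (\<lambda>x. c * f x) h = c * L2_inner M f h"
  by (simp add: L2_inner_def mult.assoc)

lemma L2_sq_diff_scale:
  assumes "f \<in> L2 M" "g \<in> L2 M"
  shows "L2_sq M (\<lambda>x. f x - c * g x)
    = L2_sq M f - 2 * Re (cnj c * L2_inner M f g) + (cmod c)\<^sup>2 * L2_sq M g"
proof -
  have eq: "(cmod (f x - c * g x))\<^sup>2
    = (cmod (f x))\<^sup>2 - 2 * Re (cnj c * (f x * cnj (g x))) + (cmod c)\<^sup>2 * (cmod (g x))\<^sup>2" for x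
  proof -
    have "(cmod (f x - c * g x))\<^sup>2
      = (cmod (f x))\<^sup>2 - 2 * Re (f x * cnj (c * g x)) + (cmod (c * g x))\<^sup>2"
      unfolding cmod_power2 by (simp add: power2_eq_square algebra_simps)
    then show ?thesis by (simp add: norm_mult power_mult_distrib mult.left_commute)
  qed
  have int: "integrable M (\<lambda>x. cnj c * (f x * cnj (g x)))"
    using integrable_L2_inner[OF assms] by simp
  have "L2_sq M (\<lambda>x. f x - c * g x)
    = L2_sq M f - 2 * (LINT x|M. Re (cnj c * (f x * cnj (g x)))) + (cmod c)\<^sup>2 * L2_sq M g"
    unfolding L2_sq_def eq using assms int[THEN integrable_Re]
    by (simp add: L2_integrable_sq del: times_complex.sel)
  also have "(LINT x|M. Re (cnj c * (f x * cnj (g x)))) = Re (cnj c * L2_inner M f g)"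
    unfolding integral_Re[OF int] by (simp add: L2_inner_def)
  finally show ?thesis .
qed

section \<open>Closed subspaces of L2\<close>

text \<open>
  Since functions are not identified modulo null sets, the closure condition asks for approximation by
  members of \<open>V\<close> at arbitrarily small distance; it makes \<open>V\<close> invariant under changes on null sets.
\<close>

definition closed_subspace :: "'a measure \<Rightarrow> ('a \<Rightarrow> complex) set \<Rightarrow> bool" where
  "closed_subspace M V \<longleftrightarrow> V \<subseteq> L2 M \<and> (\<lambda>_. 0) \<in> V \<and>
     (\<forall>f\<in>V. \<forall>g\<in>V. (\<lambda>x. f x + g x) \<in> V) \<and> (\<forall>c. \<forall>f\<in>V. (\<lambda>x. c * f x) \<in> V) \<and>
     (\<forall>f\<in>L2 M. (\<forall>e>0. \<exists>g\<in>V. L2_sq M (\<lambda>x. f x - g x) < e) \<longrightarrow> f \<in> V)"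

lemma closed_subspaceI:
  assumes "V \<subseteq> L2 M" "(\<lambda>_. 0) \<in> V"
    and "\<And>f g. f \<in> V \<Longrightarrow> g \<in> V \<Longrightarrow> (\<lambda>x. f x + g x) \<in> V"
    and "\<And>c f. f \<in> V \<Longrightarrow> (\<lambda>x. c * f x) \<in> V"
    and "\<And>f. f \<in> L2 M \<Longrightarrow> (\<And>e. e > 0 \<Longrightarrow> \<exists>g\<in>V. L2_sq M (\<lambda>x. f x - g x) < e) \<Longrightarrow> f \<in> V"
  shows "closed_subspace M V"
  unfolding closed_subspace_def using assms(1-4) by (auto intro!: assms(5))

context
  fixes M :: "'a measure" and V
  assumes V: "closed_subspace M V"
begin

lemma closed_subspace_L2: "f \<in> V \<Longrightarrow> f \<in> L2 M"
  using V by (auto simp: closed_subspace_def)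

lemma closed_subspace_zero: "(\<lambda>x. 0) \<in> V"
  using V by (auto simp: closed_subspace_def)

lemma closed_subspace_add: "f \<in> V \<Longrightarrow> g \<in> V \<Longrightarrow> (\<lambda>x. f x + g x) \<in> V"
  using V by (auto simp: closed_subspace_def)

lemma closed_subspace_scale: "f \<in> V \<Longrightarrow> (\<lambda>x. c * f x) \<in> V"
  using V by (auto simp: closed_subspace_def)

lemma closed_subspace_diff: "f \<in> V \<Longrightarrow> g \<in> V \<Longrightarrow> (\<lambda>x. f x - g x) \<in> V"
  using closed_subspace_add[of f "\<lambda>x. -1 * g x"] closed_subspace_scale[of g "-1"] by simp

lemma closed_subspace_sum:
  "(\<And>j. j \<in> F \<Longrightarrow> g j \<in> V) \<Longrightarrow> (\<lambda>x. \<Sum>j\<in>F. g j x) \<in> V"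
  by (induction F rule: infinite_finite_induct)
    (auto intro: closed_subspace_zero closed_subspace_add)

lemma closed_subspace_limit:
  assumes "f \<in> L2 M" "\<And>e. e > 0 \<Longrightarrow> \<exists>g\<in>V. L2_sq M (\<lambda>x. f x - g x) < e"
  shows "f \<in> V"
  using V assms unfolding closed_subspace_def by blast

lemma closed_subspace_limit_seq:
  assumes "f \<in> L2 M" "\<And>n::nat. g n \<in> V" "(\<lambda>n. L2_sq M (\<lambda>x. f x - g n x)) \<longlonglongrightarrow> 0"
  shows "f \<in> V"
proof (rule closed_subspace_limit[OF assms(1)])
  fix e :: real assume "e > 0"
  then have "\<forall>\<^sub>F n in sequentially. L2_sq M (\<lambda>x. f x - g n x) < e"
    using assms(3) by (simp add: order_tendstoD(2))
  then show "\<exists>g\<in>V. L2_sq M (\<lambda>x. f x - g x) < e"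
    using assms(2) by (auto simp: eventually_sequentially)
qed

text \<open>
  Pointwise domination by a square-integrable \<open>w\<close> turns pointwise convergence into convergence in L2,
  since \<open>\<bar>f - g n\<bar>\<^sup>2 \<le> 4 w\<^sup>2\<close>.
\<close>

lemma closed_subspace_dominated_limit:
  assumes g: "\<And>n::nat. g n \<in> V" and lim: "\<And>x. x \<in> space M \<Longrightarrow> (\<lambda>n. g n x) \<longlonglongrightarrow> f x"
    and dom: "\<And>n x. x \<in> space M \<Longrightarrow> cmod (g n x) \<le> w x"
    and w: "integrable M (\<lambda>x. (w x)\<^sup>2)"
    and f: "f \<in> borel_measurable M"
  shows "f \<in> V"
proof -
  note [measurable] = f g[THEN closed_subspace_L2, THEN L2_measurable]
  have fw: "cmod (f x) \<le> w x" if "x \<in> space M" for x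
    by (rule tendsto_upperbound[OF tendsto_norm[OF lim[OF that]]]) (auto simp: dom that)
  have "integrable M (\<lambda>x. (cmod (f x))\<^sup>2)"
    by (rule Bochner_Integration.integrable_bound[OF w]) (auto intro!: AE_I2 power_mono fw)
  then have L2: "f \<in> L2 M"
    by (simp add: L2_def)
  have "(\<lambda>n. LINT x|M. (cmod (f x - g n x))\<^sup>2) \<longlonglongrightarrow> (LINT x|M. 0)"
  proof (rule integral_dominated_convergence[where w = "\<lambda>x. 4 * (w x)\<^sup>2"])
    show "AE x in M. (\<lambda>n. (cmod (f x - g n x))\<^sup>2) \<longlonglongrightarrow> 0"
    proof (rule AE_I2)
      fix x assume "x \<in> space M"
      then have "(\<lambda>n. (cmod (f x - g n x))\<^sup>2) \<longlonglongrightarrow> (cmod (f x - f x))\<^sup>2"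
        by (intro tendsto_intros lim)
      then show "(\<lambda>n. (cmod (f x - g n x))\<^sup>2) \<longlonglongrightarrow> 0" by simp
    qed
    show "AE x in M. norm ((cmod (f x - g n x))\<^sup>2) \<le> 4 * (w x)\<^sup>2" for n
    proof (rule AE_I2)
      fix x assume x: "x \<in> space M"
      have "cmod (f x - g n x) \<le> 2 * w x"
        using norm_triangle_ineq4[of "f x" "g n x"] fw[OF x] dom[OF x, of n] by simp
      then have "(cmod (f x - g n x))\<^sup>2 \<le> (2 * w x)\<^sup>2"
        by (intro power_mono) auto
      then show "norm ((cmod (f x - g n x))\<^sup>2) \<le> 4 * (w x)\<^sup>2"
        by (simp add: power_mult_distrib)
    qed
  qed (use w in auto)
  then show ?thesis
    by (intro closed_subspace_limit_seq[OF L2 g]) (simp add: L2_sq_def)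
qed

end

section \<open>Orthonormal expansions\<close>

definition orthonormal :: "'a measure \<Rightarrow> 'j set \<Rightarrow> ('j \<Rightarrow> 'a \<Rightarrow> complex) \<Rightarrow> bool" where
  "orthonormal M J \<phi> \<longleftrightarrow> (\<forall>j\<in>J. \<phi> j \<in> L2 M) \<and>
     (\<forall>i\<in>J. \<forall>j\<in>J. L2_inner M (\<phi> i) (\<phi> j) = of_bool (i = j))"

definition residual :: "'a measure \<Rightarrow> ('j \<Rightarrow> 'a \<Rightarrow> complex) \<Rightarrow> ('a \<Rightarrow> complex) \<Rightarrow> 'j set \<Rightarrow> 'a \<Rightarrow> complex"
  where "residual M \<phi> f F x = f x - (\<Sum>j\<in>F. L2_inner M f (\<phi> j) * \<phi> j x)"

text \<open>
  Completeness of an orthonormal system is the statement that this set is all of L2.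
\<close>

definition expandable :: "'a measure \<Rightarrow> 'j set \<Rightarrow> ('j \<Rightarrow> 'a \<Rightarrow> complex) \<Rightarrow> ('a \<Rightarrow> complex) set" where
  "expandable M J \<phi>
    = {f \<in> L2 M. ((\<lambda>F. L2_sq M (residual M \<phi> f F)) \<longlongrightarrow> 0) (finite_subsets_at_top J)}"

context
  fixes M :: "'a measure" and J :: "'j set" and \<phi>
  assumes on: "orthonormal M J \<phi>"
begin

lemma on_L2: "j \<in> J \<Longrightarrow> \<phi> j \<in> L2 M"
  using on by (auto simp: orthonormal_def)

lemma residual_L2: "f \<in> L2 M \<Longrightarrow> F \<subseteq> J \<Longrightarrow> residual M \<phi> f F \<in> L2 M"
  unfolding residual_def by (intro L2_diff L2_sum L2_scale on_L2) auto

lemma on_sq: "j \<in> J \<Longrightarrow> L2_sq M (\<phi> j) = 1"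
proof -
  assume "j \<in> J"
  then have "L2_inner M (\<phi> j) (\<phi> j) = 1"
    using on by (auto simp: orthonormal_def)
  moreover have "L2_inner M (\<phi> j) (\<phi> j) = of_real (L2_sq M (\<phi> j))"
    by (simp only: L2_inner_def L2_sq_def complex_norm_square[symmetric] integral_complex_of_real)
  ultimately show ?thesis by simp
qed

lemma residual_insert:
  "finite F \<Longrightarrow> j \<notin> F \<Longrightarrow>
   residual M \<phi> f (insert j F) = (\<lambda>x. residual M \<phi> f F x - L2_inner M f (\<phi> j) * \<phi> j x)"
  by (auto simp: residual_def fun_eq_iff)

lemma residual_inner:
  assumes "f \<in> L2 M" "finite F" "F \<subseteq> J" "k \<in> J - F"
  shows "L2_inner M (residual M \<phi> f F) (\<phi> k) = L2_inner M f (\<phi> k)"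
  using assms(2-)
proof (induction F)
  case empty
  then show ?case by (simp add: residual_def)
next
  case (insert j F)
  then have "L2_inner M (\<phi> j) (\<phi> k) = 0"
    using on by (auto simp: orthonormal_def)
  with insert show ?case
    by (simp add: residual_insert L2_inner_diff_left residual_L2 assms(1) on_L2 L2_scale L2_inner_scale_left)
qed

text \<open>
  Pythagoras, one index at a time: subtracting the component along a new \<open>\<phi> j\<close> from the current residual
  lowers the squared norm by \<open>\<bar>\<langle>f, \<phi> j\<rangle>\<bar>\<^sup>2\<close>, because by orthogonality the residual still has the coefficient of \<open>f\<close>
  there.
\<close>

lemma residual_sq:
  assumes "f \<in> L2 M" "finite F" "F \<subseteq> J"
  shows "L2_sq M (residual M \<phi> f F) = L2_sq M f - (\<Sum>j\<in>F. (cmod (L2_inner M f (\<phi> j)))\<^sup>2)"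
  using assms(2-)
proof (induction F)
  case empty
  then show ?case by (simp add: residual_def)
next
  case (insert j F)
  have "Re (cnj z * z) = (cmod z)\<^sup>2" for z
    unfolding cmod_power2 by (simp add: power2_eq_square)
  with insert show ?case
    by (simp add: residual_insert L2_sq_diff_scale residual_L2 assms(1) on_L2 residual_inner on_sq)
qed

lemma residual_sq_le:
  "f \<in> L2 M \<Longrightarrow> finite F \<Longrightarrow> F \<subseteq> J \<Longrightarrow> L2_sq M (residual M \<phi> f F) \<le> L2_sq M f"
  by (simp add: residual_sq sum_nonneg)

lemma residual_add:
  "f \<in> L2 M \<Longrightarrow> g \<in> L2 M \<Longrightarrow> F \<subseteq> J \<Longrightarrow>
   residual M \<phi> (\<lambda>x. f x + g x) F = (\<lambda>x. residual M \<phi> f F x + residual M \<phi> g F x)"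
  by (simp add: residual_def fun_eq_iff L2_inner_add_left on_L2 sum.distrib ring_distribs subset_iff)

lemma residual_scale: "residual M \<phi> (\<lambda>x. c * f x) F = (\<lambda>x. c * residual M \<phi> f F x)"
  by (simp add: residual_def fun_eq_iff L2_inner_scale_left sum_distrib_left right_diff_distrib mult.assoc)

lemma expandable_member:
  assumes "j \<in> J"
  shows "\<phi> j \<in> expandable M J \<phi>"
proof -
  have "\<forall>\<^sub>F F in finite_subsets_at_top J. L2_sq M (residual M \<phi> (\<phi> j) F) = 0"
  proof (rule eventually_finite_subsets_at_top[THEN iffD2], intro exI conjI allI impI)
    show "finite {j}" "{j} \<subseteq> J" using assms by auto
    fix F assume F: "finite F \<and> {j} \<subseteq> F \<and> F \<subseteq> J"
    have "(\<Sum>i\<in>F. (cmod (L2_inner M (\<phi> j) (\<phi> i)))\<^sup>2) = (\<Sum>i\<in>F. of_bool (j = i))"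
      using on F assms by (intro sum.cong) (auto simp: orthonormal_def)
    also have "\<dots> = (1::real)"
      using F by (simp add: of_bool_def)
    finally show "L2_sq M (residual M \<phi> (\<phi> j) F) = 0"
      using F assms by (simp add: residual_sq on_L2 on_sq)
  qed
  then show ?thesis
    unfolding expandable_def using on_L2[OF assms] by (auto intro: tendsto_eventually)
qed

text \<open>
  The residual map does not increase the norm, uniformly in the finite set \<open>F\<close>. Hence, if \<open>g\<close> is close
  to \<open>f\<close>, the residual of \<open>f\<close> is close to that of \<open>g\<close> for all \<open>F\<close> at once, and convergence for \<open>g\<close> passes
  to \<open>f\<close>.
\<close>

lemma closed_subspace_expandable: "closed_subspace M (expandable M J \<phi>)"
proof (rule closed_subspaceI)
  let ?T = "finite_subsets_at_top J"
  have finJ: "\<forall>\<^sub>F F in ?T. finite F \<and> F \<subseteq> J"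
    by (rule eventually_finite_subsets_at_top_weakI) auto
  show "expandable M J \<phi> \<subseteq> L2 M"
    by (auto simp: expandable_def)
  show "(\<lambda>_. 0) \<in> expandable M J \<phi>"
    by (simp add: expandable_def L2_zero residual_def L2_inner_def L2_sq_def)
  have le: "L2_sq M (residual M \<phi> (\<lambda>x. f x + g x) F)
      \<le> 2 * L2_sq M (residual M \<phi> f F) + 2 * L2_sq M (residual M \<phi> g F)"
    if "f \<in> L2 M" "g \<in> L2 M" "F \<subseteq> J" for f g F
    using that by (simp add: residual_add L2_sq_add_le residual_L2)
  show "(\<lambda>x. f x + g x) \<in> expandable M J \<phi>" if "f \<in> expandable M J \<phi>" "g \<in> expandable M J \<phi>" for f g
  proof -
    from that have *: "f \<in> L2 M" "g \<in> L2 M"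
      "((\<lambda>F. L2_sq M (residual M \<phi> f F)) \<longlongrightarrow> 0) ?T" "((\<lambda>F. L2_sq M (residual M \<phi> g F)) \<longlongrightarrow> 0) ?T"
      by (auto simp: expandable_def)
    have "((\<lambda>F. 2 * L2_sq M (residual M \<phi> f F) + 2 * L2_sq M (residual M \<phi> g F)) \<longlongrightarrow> 2 * 0 + 2 * 0) ?T"
      by (intro tendsto_intros *)
    then have "((\<lambda>F. 2 * L2_sq M (residual M \<phi> f F) + 2 * L2_sq M (residual M \<phi> g F)) \<longlongrightarrow> 0) ?T"
      by simp
    then have "((\<lambda>F. L2_sq M (residual M \<phi> (\<lambda>x. f x + g x) F)) \<longlongrightarrow> 0) ?T"
      by (rule tendsto_sandwich[OF _ _ tendsto_const, rotated 2])
        (auto simp: L2_sq_nonneg intro!: eventually_mono[OF finJ] le *)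
    then show ?thesis
      using * by (simp add: expandable_def L2_add)
  qed
  show "(\<lambda>x. c * f x) \<in> expandable M J \<phi>" if "f \<in> expandable M J \<phi>" for c f
    using that by (auto simp: expandable_def L2_scale residual_scale L2_sq_scale intro: tendsto_mult_right_zero)
  fix f assume f: "f \<in> L2 M"
    and approx: "\<And>e. e > 0 \<Longrightarrow> \<exists>g\<in>expandable M J \<phi>. L2_sq M (\<lambda>x. f x - g x) < e"
  have "((\<lambda>F. L2_sq M (residual M \<phi> f F)) \<longlongrightarrow> 0) ?T"
  proof (rule order_tendstoI)
    fix e :: real assume "e > 0"
    then obtain g where g: "g \<in> expandable M J \<phi>" "L2_sq M (\<lambda>x. f x - g x) < e / 4"
      using approx[of "e / 4"] by auto
    then have gL: "g \<in> L2 M" by (simp add: expandable_def)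
    have "\<forall>\<^sub>F F in ?T. L2_sq M (residual M \<phi> g F) < e / 4"
      using g \<open>e > 0\<close> by (intro order_tendstoD(2)[of _ 0]) (auto simp: expandable_def)
    then show "\<forall>\<^sub>F F in ?T. L2_sq M (residual M \<phi> f F) < e"
      using finJ
    proof eventually_elim
      case (elim F)
      have "L2_sq M (residual M \<phi> f F) = L2_sq M (residual M \<phi> (\<lambda>x. (f x - g x) + g x) F)"
        by simp
      also have "\<dots> \<le> 2 * L2_sq M (residual M \<phi> (\<lambda>x. f x - g x) F) + 2 * L2_sq M (residual M \<phi> g F)"
        using elim by (intro le L2_diff f gL) auto
      also have "L2_sq M (residual M \<phi> (\<lambda>x. f x - g x) F) \<le> L2_sq M (\<lambda>x. f x - g x)"
        using elim by (intro residual_sq_le L2_diff f gL) auto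
      finally show ?case using g elim by simp
    qed
  qed (auto intro!: always_eventually less_le_trans[OF _ L2_sq_nonneg])
  with f show "f \<in> expandable M J \<phi>"
    by (simp add: expandable_def)
qed

lemma complete_orthonormal:
  assumes "L2 M \<subseteq> expandable M J \<phi>" and f: "f \<in> L2 M"
  shows "((\<lambda>j. (cmod (L2_inner M f (\<phi> j)))\<^sup>2) has_sum L2_sq M f) J"
    and "L2_has_sum M (\<lambda>j x. L2_inner M f (\<phi> j) * \<phi> j x) J f"
proof -
  have lim: "((\<lambda>F. L2_sq M (residual M \<phi> f F)) \<longlongrightarrow> 0) (finite_subsets_at_top J)"
    using assms by (auto simp: expandable_def)
  have "((\<lambda>F. L2_sq M f - L2_sq M (residual M \<phi> f F)) \<longlongrightarrow> L2_sq M f - 0) (finite_subsets_at_top J)"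
    by (intro tendsto_intros lim)
  moreover have "\<forall>\<^sub>F F in finite_subsets_at_top J.
      L2_sq M f - L2_sq M (residual M \<phi> f F) = (\<Sum>j\<in>F. (cmod (L2_inner M f (\<phi> j)))\<^sup>2)"
    by (rule eventually_finite_subsets_at_top_weakI) (simp add: residual_sq f)
  ultimately show "((\<lambda>j. (cmod (L2_inner M f (\<phi> j)))\<^sup>2) has_sum L2_sq M f) J"
    unfolding has_sum_def by (simp add: tendsto_cong)
  have "((\<lambda>F. sqrt (L2_sq M (residual M \<phi> f F))) \<longlongrightarrow> sqrt 0) (finite_subsets_at_top J)"
    by (intro tendsto_intros lim)
  moreover have "L2_norm M (\<lambda>x. (\<Sum>j\<in>F. L2_inner M f (\<phi> j) * \<phi> j x) - f x)
      = sqrt (L2_sq M (residual M \<phi> f F))" for F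
    unfolding L2_norm_eq residual_def by (subst L2_sq_minus_commute) simp
  ultimately show "L2_has_sum M (\<lambda>j x. L2_inner M f (\<phi> j) * \<phi> j x) J f"
    unfolding L2_has_sum_def by (auto simp: f intro: L2_scale on_L2)
qed

end

lemma filterlim_finite_subsets_at_top_Int:
  assumes "C \<subseteq> D"
  shows "filterlim (\<lambda>F. F \<inter> C) (finite_subsets_at_top C) (finite_subsets_at_top D)"
  unfolding filterlim_finite_subsets_at_top
proof (intro allI impI)
  fix X assume "finite X \<and> X \<subseteq> C"
  with assms show "\<forall>\<^sub>F F in finite_subsets_at_top D. finite (F \<inter> C) \<and> X \<subseteq> F \<inter> C \<and> F \<inter> C \<subseteq> C"
    unfolding eventually_finite_subsets_at_top by (intro exI[of _ X]) auto
qed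

text \<open>
  A finite subset of \<open>A \<union> B\<close> splits into its traces on \<open>A\<close> and \<open>B\<close>, which exhaust \<open>A\<close> and \<open>B\<close>
  respectively.
\<close>

lemma L2_has_sum_Un_disjoint:
  assumes A: "L2_has_sum M g A s" and B: "L2_has_sum M g B t" and disj: "A \<inter> B = {}"
  shows "L2_has_sum M g (A \<union> B) (\<lambda>x. s x + t x)"
proof -
  have gL: "g j \<in> L2 M" if "j \<in> A \<union> B" for j
    using that A B by (auto simp: L2_has_sum_def)
  have stL: "s \<in> L2 M" "t \<in> L2 M"
    using A B by (auto simp: L2_has_sum_def)
  define d where "d F s = L2_sq M (\<lambda>x. (\<Sum>j\<in>F. g j x) - s x)" for F s
  have restr: "((\<lambda>F. d (F \<inter> C) u) \<longlongrightarrow> 0) (finite_subsets_at_top (A \<union> B))"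
    if "L2_has_sum M g C u" "C \<subseteq> A \<union> B" for C u
  proof -
    have "filterlim (\<lambda>F. F \<inter> C) (finite_subsets_at_top C) (finite_subsets_at_top (A \<union> B))"
      using that(2) by (rule filterlim_finite_subsets_at_top_Int)
    moreover have "((\<lambda>F. (L2_norm M (\<lambda>x. (\<Sum>j\<in>F. g j x) - u x))\<^sup>2) \<longlongrightarrow> 0\<^sup>2) (finite_subsets_at_top C)"
      using that(1) by (intro tendsto_intros) (simp add: L2_has_sum_def)
    ultimately show ?thesis
      by (auto simp: d_def L2_norm_sq intro: filterlim_compose)
  qed
  have "((\<lambda>F. 2 * d (F \<inter> A) s + 2 * d (F \<inter> B) t) \<longlongrightarrow> 2 * 0 + 2 * 0) (finite_subsets_at_top (A \<union> B))"
    by (intro tendsto_intros restr A B) auto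
  then have lim0: "((\<lambda>F. 2 * d (F \<inter> A) s + 2 * d (F \<inter> B) t) \<longlongrightarrow> 0) (finite_subsets_at_top (A \<union> B))"
    by simp
  have "\<forall>\<^sub>F F in finite_subsets_at_top (A \<union> B).
      d F (\<lambda>x. s x + t x) \<le> 2 * d (F \<inter> A) s + 2 * d (F \<inter> B) t"
  proof (rule eventually_finite_subsets_at_top_weakI)
    fix F assume F: "finite F" "F \<subseteq> A \<union> B"
    have "(\<Sum>j\<in>F. g j x) = (\<Sum>j\<in>F \<inter> A. g j x) + (\<Sum>j\<in>F \<inter> B. g j x)" for x
      using F disj by (subst sum.union_disjoint[symmetric]) (auto intro!: sum.cong)
    then have "d F (\<lambda>x. s x + t x)
      = L2_sq M (\<lambda>x. ((\<Sum>j\<in>F \<inter> A. g j x) - s x) + ((\<Sum>j\<in>F \<inter> B. g j x) - t x))"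
      by (simp add: d_def algebra_simps)
    also have "\<dots> \<le> 2 * d (F \<inter> A) s + 2 * d (F \<inter> B) t"
      unfolding d_def by (intro L2_sq_add_le L2_diff L2_sum stL gL) auto
    finally show "d F (\<lambda>x. s x + t x) \<le> 2 * d (F \<inter> A) s + 2 * d (F \<inter> B) t" .
  qed
  then have "((\<lambda>F. d F (\<lambda>x. s x + t x)) \<longlongrightarrow> 0) (finite_subsets_at_top (A \<union> B))"
    by (rule tendsto_sandwich[OF _ _ tendsto_const lim0, rotated]) (simp add: d_def L2_sq_nonneg)
  then have "((\<lambda>F. sqrt (d F (\<lambda>x. s x + t x))) \<longlongrightarrow> sqrt 0) (finite_subsets_at_top (A \<union> B))"
    by (intro tendsto_intros)
  then show ?thesis
    unfolding L2_has_sum_def L2_norm_eq using gL stL by (auto simp: d_def L2_add)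
qed

section \<open>Haar functions of dyadic intervals\<close>

lemma dyadic_interval_iff: "x \<in> dyadic_interval k j \<longleftrightarrow> \<lfloor>x * 2 powi k\<rfloor> = j"
proof -
  have pos: "(0::real) < 2 powi k" by simp
  have "(2::real) powi (- k) = 1 / 2 powi k"
    by (simp add: power_int_minus divide_inverse)
  then have "x \<in> dyadic_interval k j \<longleftrightarrow> of_int j \<le> x * 2 powi k \<and> x * 2 powi k < of_int j + 1"
    using pos by (simp add: dyadic_interval_def pos_divide_le_eq pos_less_divide_eq)
  then show ?thesis by (simp add: floor_eq_iff)
qed

text \<open>
  This form of the nesting property of dyadic intervals shows that membership in an interval of the
  coarser scale \<open>k\<close> is decided by the index at the finer scale \<open>l\<close> alone: dividing by \<open>2 ^ (l - k)\<close> and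
  rounding down commutes with taking the floor.
\<close>

lemma dyadic_interval_refine:
  assumes "k \<le> l" "x \<in> dyadic_interval l i"
  shows "x \<in> dyadic_interval k j \<longleftrightarrow> i div 2 ^ nat (l - k) = j"
proof -
  have "x * 2 powi k = x * 2 powi l / real_of_int (2 ^ nat (l - k))"
  proof -
    have "(2::real) powi l = 2 powi (k + int (nat (l - k)))"
      using assms(1) by simp
    also have "\<dots> = 2 powi k * 2 ^ nat (l - k)"
      by (metis power_int_add power_int_of_nat zero_neq_numeral)
    finally show ?thesis by simp
  qed
  moreover have "\<lfloor>y / real_of_int (2 ^ n)\<rfloor> = \<lfloor>y\<rfloor> div 2 ^ n" for y n
    using floor_divide_real_eq_div[of "2 ^ n" y] by simp
  ultimately show ?thesis
    using assms(2) by (simp only: dyadic_interval_iff)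
qed

lemma dyadic_interval_halves:
  "left_half (dyadic_interval k j) = dyadic_interval (k + 1) (2 * j)" (is ?l)
  "right_half (dyadic_interval k j) = dyadic_interval (k + 1) (2 * j + 1)" (is ?r)
proof -
  have lt: "real_of_int j * 2 powi - k < (real_of_int j + 1) * 2 powi - k"
    by simp
  have mid: "(Inf (dyadic_interval k j) + Sup (dyadic_interval k j)) / 2
      = (real_of_int j + 1 / 2) * 2 powi - k"
    unfolding dyadic_interval_def using lt by (simp add: field_simps)
  define q :: real where "q = 2 powi (- (k + 1))"
  have q: "2 powi - k = 2 * q"
    using power_int_add[of "2::real" "- (k + 1)" 1] by (simp add: q_def)
  have coarse: "dyadic_interval k j = {of_int j * (2 * q) ..< (of_int j + 1) * (2 * q)}"
    by (simp add: dyadic_interval_def q)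
  have fine: "dyadic_interval (k + 1) i = {of_int i * q ..< (of_int i + 1) * q}" for i
    by (simp only: dyadic_interval_def q_def)
  have "0 < q" by (simp add: q_def)
  then show ?l ?r
    unfolding left_half_def right_half_def mid unfolding coarse fine q
    by (auto simp: algebra_simps)
qed

lemma measure_dyadic_interval: "measure lborel (dyadic_interval k j) = 2 powi - k"
  by (simp add: dyadic_interval_def algebra_simps)

lemma dyadic_interval_sets [measurable]: "dyadic_interval k j \<in> sets borel"
  by (simp add: dyadic_interval_def)

lemma integrable_dyadic_interval [simp]: "integrable lborel (indicat_real (dyadic_interval k j))"
  by (simp add: dyadic_interval_def)

lemma haar_dyadic:
  "haar_interval b (dyadic_interval k j) x =
    (if b then indicator (dyadic_interval (k + 1) (2 * j)) x - indicator (dyadic_interval (k + 1) (2 * j + 1)) x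
     else indicator (dyadic_interval k j) x) / sqrt (2 powi - k)"
  by (simp add: haar_interval_def measure_dyadic_interval dyadic_interval_halves)

lemma haar_dyadic_measurable [measurable]:
  "haar_interval b (dyadic_interval k j) \<in> borel_measurable borel"
  unfolding haar_dyadic by measurable

lemma indicator_dyadic_halves:
  "indicator (dyadic_interval k j) x
    = (indicator (dyadic_interval (k + 1) (2 * j)) x + indicator (dyadic_interval (k + 1) (2 * j + 1)) x :: real)"
proof -
  define i where "i = \<lfloor>x * 2 powi (k + 1)\<rfloor>"
  then have "x \<in> dyadic_interval (k + 1) i" by (simp add: dyadic_interval_iff)
  then have "x \<in> dyadic_interval k j \<longleftrightarrow> i div 2 = j"
    using dyadic_interval_refine[of k "k + 1"] by simp
  then show ?thesis
    by (auto simp: indicator_def dyadic_interval_iff[of _ "k + 1"] i_def[symmetric])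
qed

lemma integral_haar_dyadic: "(LINT x|lborel. haar_interval True (dyadic_interval k j) x) = 0"
  by (simp add: haar_dyadic measure_dyadic_interval)

text \<open>
  On one interval \<open>K\<close> the squares of \<open>h_K^0\<close> and \<open>h_K^1\<close> are constant, and \<open>h_K^0\<close> itself is constant. So a
  mixed product is a multiple of \<open>h_K^1\<close>, which integrates to zero.
\<close>

lemma haar_dyadic_mult_same_scale:
  "haar_interval a (dyadic_interval k i) x * haar_interval b (dyadic_interval k j) x =
    (if i \<noteq> j then 0
     else if a = b then indicator (dyadic_interval k j) x / 2 powi - k
     else haar_interval True (dyadic_interval k j) x / sqrt (2 powi - k))"
proof -
  have s: "sqrt (2 powi - k) * sqrt (2 powi - k) = (2::real) powi - k"
    by simp
  have disj: "x \<in> dyadic_interval l u \<Longrightarrow> x \<in> dyadic_interval l v \<Longrightarrow> u = v" for l u v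
    by (simp add: dyadic_interval_iff)
  have c: "x \<in> dyadic_interval (k + 1) (2 * u) \<or> x \<in> dyadic_interval (k + 1) (2 * u + 1) \<longleftrightarrow> x \<in> dyadic_interval k u" for u
    using indicator_dyadic_halves[of k u x] disj[of "k + 1" "2 * u" "2 * u + 1"]
    by (auto simp: indicator_def of_bool_def split: if_splits)
  have *: "indicator (dyadic_interval l u) x = (0::real) \<or> indicator (dyadic_interval l u) x = (1::real)" for l u
    by (simp add: indicator_def)
  show ?thesis
  proof (cases "x \<in> dyadic_interval k i \<and> x \<in> dyadic_interval k j")
    case True
    then have "i = j" using disj by blast
    moreover have "x \<in> dyadic_interval (k + 1) (2 * j) \<and> x \<notin> dyadic_interval (k + 1) (2 * j + 1) \<or>
      x \<notin> dyadic_interval (k + 1) (2 * j) \<and> x \<in> dyadic_interval (k + 1) (2 * j + 1)"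
      using True c[of j] disj[of "k + 1" "2 * j" "2 * j + 1"] by auto
    ultimately show ?thesis
      using True s by (cases a; cases b) (auto simp: haar_dyadic)
  next
    case False
    then show ?thesis
      using c[of i] c[of j] by (auto simp: haar_dyadic indicator_def)
  qed
qed

lemma integrable_haar_dyadic_mult:
  "integrable lborel (\<lambda>x. haar_interval a (dyadic_interval k i) x * haar_interval b (dyadic_interval l j) x)"
proof (rule Bochner_Integration.integrable_bound)
  show "integrable lborel (\<lambda>x. 1 / sqrt (2 powi - k) * (1 / sqrt (2 powi - l)) * indicat_real (dyadic_interval l j) x)"
    by simp
  have bd: "\<bar>haar_interval b (dyadic_interval k i) x\<bar> \<le> 1 / sqrt (2 powi - k) * indicator (dyadic_interval k i) x" for b k i x
    using indicator_dyadic_halves[of k i x]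
    by (auto simp: haar_dyadic abs_divide divide_right_mono indicator_def split: if_splits)
  show "AE x in lborel. norm (haar_interval a (dyadic_interval k i) x * haar_interval b (dyadic_interval l j) x)
    \<le> norm (1 / sqrt (2 powi - k) * (1 / sqrt (2 powi - l)) * indicat_real (dyadic_interval l j) x)"
  proof (rule AE_I2)
    fix x
    have "\<bar>haar_interval a (dyadic_interval k i) x\<bar> * \<bar>haar_interval b (dyadic_interval l j) x\<bar>
      \<le> (1 / sqrt (2 powi - k)) * (1 / sqrt (2 powi - l) * indicator (dyadic_interval l j) x)"
      by (intro mult_mono bd order_trans[OF bd[of a k i x]]) (auto simp: indicator_def)
    then show "norm (haar_interval a (dyadic_interval k i) x * haar_interval b (dyadic_interval l j) x)
      \<le> norm (1 / sqrt (2 powi - k) * (1 / sqrt (2 powi - l)) * indicat_real (dyadic_interval l j) x)"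
      by (simp add: abs_mult mult.assoc)
  qed
qed simp

lemma integral_haar_dyadic_mult_same_scale:
  "(LINT x|lborel. haar_interval a (dyadic_interval k i) x * haar_interval b (dyadic_interval k j) x)
    = of_bool (i = j \<and> a = b)"
  unfolding haar_dyadic_mult_same_scale
  by (cases "i = j"; cases a; cases b) (auto simp: integral_haar_dyadic measure_dyadic_interval)

lemma haar_dyadic_const:
  assumes "k < l"
  shows "\<exists>c. \<forall>x\<in>dyadic_interval l j. haar_interval a (dyadic_interval k i) x = c"
proof -
  have "x \<in> dyadic_interval n u \<longleftrightarrow> j div 2 ^ nat (l - n) = u"
    if "x \<in> dyadic_interval l j" "n \<le> l" for n u x
    using dyadic_interval_refine that by blast
  then have "haar_interval a (dyadic_interval k i) x =
      (if a then of_bool (j div 2 ^ nat (l - (k + 1)) = 2 * i) - of_bool (j div 2 ^ nat (l - (k + 1)) = 2 * i + 1)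
       else of_bool (j div 2 ^ nat (l - k) = i)) / sqrt (2 powi - k)"
    if "x \<in> dyadic_interval l j" for x
    using assms that by (simp add: haar_dyadic indicator_def)
  then show ?thesis by blast
qed

text \<open>
  On the support of the finer factor the coarser one is constant, and the finer one has mean zero.
\<close>

lemma integral_haar_dyadic_mult_finer:
  assumes "k < l"
  shows "(LINT x|lborel. haar_interval a (dyadic_interval k i) x * haar_interval True (dyadic_interval l j) x) = 0"
proof -
  obtain c where c: "\<And>x. x \<in> dyadic_interval l j \<Longrightarrow> haar_interval a (dyadic_interval k i) x = c"
    using haar_dyadic_const[OF assms] by metis
  have "haar_interval True (dyadic_interval l j) x = 0" if "x \<notin> dyadic_interval l j" for x
    using indicator_dyadic_halves[of l j x] that
    by (auto simp: haar_dyadic indicator_def of_bool_def split: if_splits)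
  with c have "haar_interval a (dyadic_interval k i) x * haar_interval True (dyadic_interval l j) x
      = c * haar_interval True (dyadic_interval l j) x" for x
    by (cases "x \<in> dyadic_interval l j") auto
  then have "(LINT x|lborel. haar_interval a (dyadic_interval k i) x * haar_interval True (dyadic_interval l j) x)
      = (LINT x|lborel. c * haar_interval True (dyadic_interval l j) x)"
    by (intro Bochner_Integration.integral_cong) auto
  then show ?thesis by (simp add: integral_haar_dyadic)
qed

section \<open>Haar functions of dyadic cubes are orthonormal\<close>

definition dyadic_cube :: "int \<Rightarrow> ('n \<Rightarrow> int) \<Rightarrow> (real ^ 'n) set" where
  "dyadic_cube k j = {x. \<forall>i. x $ i \<in> dyadic_interval k (j i)}"

lemma dyadic_cubes_eq: "dyadic_cubes = {dyadic_cube k j |k j. True}"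
  by (simp add: dyadic_cubes_def dyadic_cube_def)

lemma proj_dyadic_cube: "(\<lambda>y. y $ i) ` dyadic_cube k j = dyadic_interval k (j i)"
proof
  show "dyadic_interval k (j i) \<subseteq> (\<lambda>y. y $ i) ` dyadic_cube k j"
  proof
    fix t assume t: "t \<in> dyadic_interval k (j i)"
    have "(\<chi> u. if u = i then t else of_int (j u) * 2 powi (- k)) \<in> dyadic_cube k j"
      using t by (auto simp: dyadic_cube_def) (simp add: dyadic_interval_def)
    then show "t \<in> (\<lambda>y. y $ i) ` dyadic_cube k j"
      by (rule rev_image_eqI) simp
  qed
qed (auto simp: dyadic_cube_def)

lemma haar_cube_dyadic:
  "haar_cube a (dyadic_cube k j) x = (\<Prod>i\<in>UNIV. haar_interval (a i) (dyadic_interval k (j i)) (x $ i))"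
  by (simp add: haar_cube_def proj_dyadic_cube)

lemma haar_cube_measurable [measurable]:
  "haar_cube a (dyadic_cube k j) \<in> borel_measurable borel"
  unfolding haar_cube_dyadic by measurable

text \<open>
  Lebesgue measure on \<^typ>\<open>real ^ 'n\<close> is by construction the image of a product measure indexed by the
  standard basis; the proof only reindexes coordinates by \<^typ>\<open>'n\<close>.
\<close>

lemma
  fixes f :: "'n::finite \<Rightarrow> real \<Rightarrow> real"
  assumes f: "\<And>i. integrable lborel (f i)"
  shows integral_lborel_prod_vec:
      "(LINT x|lborel. (\<Prod>i\<in>UNIV. f i (x $ i))) = (\<Prod>i\<in>UNIV. LINT t|lborel. f i t)"
    and integrable_lborel_prod_vec: "integrable lborel (\<lambda>x. \<Prod>i\<in>UNIV. f i (x $ i))"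
proof -
  interpret product_sigma_finite "\<lambda>_::real ^ 'n. lborel :: real measure" ..
  have bij: "bij_betw (\<lambda>i. axis i (1::real)) (UNIV :: 'n set) Basis"
    unfolding bij_betw_def Basis_vec_def by (auto simp: inj_on_def axis_eq_axis)
  define g where "g b = f (THE i. b = axis i 1)" for b :: "real ^ 'n"
  have g: "g (axis i 1) = f i" for i
    by (simp add: g_def axis_eq_axis)
  have reindex: "(\<Prod>b\<in>Basis. h b) = (\<Prod>i\<in>UNIV. h (axis i (1::real)))" for h :: "real ^ 'n \<Rightarrow> real"
    using prod.reindex_bij_betw[OF bij, of h] by simp
  have gint: "integrable lborel (g b)" if "b \<in> Basis" for b
    using that f by (auto simp: g Basis_vec_def)
  have [measurable]: "f i \<in> borel_measurable borel" for i
    using f by (auto dest: borel_measurable_integrable)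
  let ?P = "Pi\<^sub>M (Basis :: (real ^ 'n) set) (\<lambda>_. lborel :: real measure)"
  let ?T = "\<lambda>w. \<Sum>b\<in>(Basis :: (real ^ 'n) set). w b *\<^sub>R b"
  have T: "?T w $ i = w (axis i 1)" for w i
  proof -
    have "?T w $ i = ?T w \<bullet> axis i 1"
      by (simp add: inner_axis)
    also have "\<dots> = w (axis i 1)"
      by (subst inner_sum_left_Basis) (auto simp: Basis_vec_def)
    finally show ?thesis .
  qed
  have eq: "(\<Prod>i\<in>UNIV. f i (?T w $ i)) = (\<Prod>b\<in>Basis. g b (w b))" for w
    by (simp only: reindex g T)
  have [measurable]: "?T \<in> measurable ?P borel"
    by measurable
  have "(LINT x|lborel. (\<Prod>i\<in>UNIV. f i (x $ i))) = (LINT w|?P. (\<Prod>i\<in>UNIV. f i (?T w $ i)))"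
    by (subst lborel_eq) (rule integral_distr; measurable)
  also have "\<dots> = (\<Prod>b\<in>Basis. LINT t|lborel. g b t)"
    unfolding eq by (rule product_integral_prod) (auto simp: gint)
  finally show "(LINT x|lborel. (\<Prod>i\<in>UNIV. f i (x $ i))) = (\<Prod>i\<in>UNIV. LINT t|lborel. f i t)"
    by (simp add: reindex g)
  have "integrable ?P (\<lambda>w. \<Prod>i\<in>UNIV. f i (?T w $ i))"
    unfolding eq by (rule product_integrable_prod) (auto simp: gint)
  then show "integrable lborel (\<lambda>x. \<Prod>i\<in>UNIV. f i (x $ i))"
    by (subst lborel_eq, subst integrable_distr_eq) measurable
qed

lemma integrable_haar_cube_mult:
  "integrable lborel (\<lambda>x. haar_cube a (dyadic_cube k u) x * haar_cube b (dyadic_cube l v) x)"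
  unfolding haar_cube_dyadic prod.distrib[symmetric]
  by (rule integrable_lborel_prod_vec[where f = "\<lambda>i t. haar_interval (a i) (dyadic_interval k (u i)) t *
    haar_interval (b i) (dyadic_interval l (v i)) t"]) (rule integrable_haar_dyadic_mult)

lemma integral_haar_cube_mult:
  "(LINT x|lborel. haar_cube a (dyadic_cube k u) x * haar_cube b (dyadic_cube l v) x)
    = (\<Prod>i\<in>UNIV. LINT t|lborel. haar_interval (a i) (dyadic_interval k (u i)) t *
        haar_interval (b i) (dyadic_interval l (v i)) t)"
  unfolding haar_cube_dyadic prod.distrib[symmetric]
  by (rule integral_lborel_prod_vec[where f = "\<lambda>i t. haar_interval (a i) (dyadic_interval k (u i)) t *
    haar_interval (b i) (dyadic_interval l (v i)) t"]) (rule integrable_haar_dyadic_mult)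

text \<open>
  The signature \<open>b\<close> of the finer cube has a nonzero entry \<open>i\<close>, and the integral over the \<open>i\<close>-th
  coordinate already vanishes.
\<close>

lemma integral_haar_cube_finer:
  assumes "k < l" "b \<in> signatures"
  shows "(LINT x|lborel. haar_cube a (dyadic_cube k u) x * haar_cube b (dyadic_cube l v) x) = 0"
proof -
  from assms(2) obtain i where "b i" by (auto simp: signatures_def fun_eq_iff)
  then show ?thesis
    unfolding integral_haar_cube_mult
    by (intro prod_zero) (auto intro!: exI[of _ i] integral_haar_dyadic_mult_finer assms)
qed

lemma haar_cube_orthonormal:
  assumes "I \<in> dyadic_cubes" "J \<in> dyadic_cubes" "a \<in> signatures" "b \<in> signatures"
  shows "(LINT x|lborel. haar_cube a I x * haar_cube b J x) = of_bool (I = J \<and> a = b)"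
proof -
  obtain k u l v where I: "I = dyadic_cube k u" and J: "J = dyadic_cube l v"
    using assms(1,2) by (auto simp: dyadic_cubes_eq)
  have same: "(LINT x|lborel. haar_cube a (dyadic_cube k u) x * haar_cube b (dyadic_cube k v) x)
      = of_bool (u = v \<and> a = b)" for k u v
  proof (cases "u = v \<and> a = b")
    case False
    then obtain i where "u i \<noteq> v i \<or> a i \<noteq> b i" by (auto simp: fun_eq_iff)
    then have "(LINT x|lborel. haar_cube a (dyadic_cube k u) x * haar_cube b (dyadic_cube k v) x) = 0"
      unfolding integral_haar_cube_mult integral_haar_dyadic_mult_same_scale
      by (intro prod_zero) (auto intro!: exI[of _ i])
    then show ?thesis using False by simp
  qed (simp add: integral_haar_cube_mult integral_haar_dyadic_mult_same_scale)
  consider "k < l" | "l < k" | "k = l" by linarith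
  then show ?thesis
  proof cases
    case 1
    \<comment> \<open>The same set cannot arise at both scales: its Haar function would be orthogonal to itself.\<close>
    have "I = J \<and> a = b \<Longrightarrow> False"
      using integral_haar_cube_finer[OF 1 assms(4), of a u v] same[of k u u]
      by (auto simp: I J)
    then show ?thesis
      using integral_haar_cube_finer[OF 1 assms(4), of a u v] by (auto simp: I J)
  next
    case 2
    have "I = J \<and> a = b \<Longrightarrow> False"
      using integral_haar_cube_finer[OF 2 assms(3), of b v u] same[of l v v]
      by (auto simp: I J)
    then show ?thesis
      using integral_haar_cube_finer[OF 2 assms(3), of b v u] by (auto simp: I J mult.commute)
  next
    case 3
    have "u = v" if "dyadic_cube k u = dyadic_cube k v"
    proof
      fix i
      have "dyadic_interval k (u i) = dyadic_interval k (v i)"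
        using that by (metis proj_dyadic_cube)
      moreover have "of_int (u i) * 2 powi - k \<in> dyadic_interval k (u i)"
        by (simp add: dyadic_interval_def)
      ultimately show "u i = v i" by (auto simp: dyadic_interval_iff)
    qed
    then show ?thesis using same[of k u v] 3 by (auto simp: I J)
  qed
qed

lemma indicator_dyadic_cube:
  "indicator (dyadic_cube k j) x = (\<Prod>i\<in>UNIV. indicator (dyadic_interval k (j i)) (x $ i) :: real)"
  by (auto simp: dyadic_cube_def indicator_def prod_zero_iff)

text \<open>
  In one variable the indicator of either half of \<open>K\<close> is a combination of \<open>h_K^0\<close> and \<open>h_K^1\<close>, with
  coefficient \<open>sqrt \<bar>K\<bar> / 2\<close> at \<open>h_K^0\<close>. Multiplying these out over the coordinates gives one term per
  element of \<open>{0, 1}^m\<close>; the zero element contributes the indicator of the parent cube.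
\<close>

lemma indicator_dyadic_cube_refine:
  fixes j :: "'n::finite \<Rightarrow> int"
  defines "p \<equiv> (\<lambda>i. j i div 2)"
  shows "\<exists>c. \<forall>x. indicator (dyadic_cube (k + 1) j) x =
    indicator (dyadic_cube k p) x / 2 ^ CARD('n) +
    (\<Sum>a\<in>signatures. c a * haar_cube a (dyadic_cube k p) x)"
proof -
  define s :: real where "s = sqrt (2 powi - k)"
  have s: "s \<noteq> 0" by (simp add: s_def)
  define c where "c i b = (if b \<and> odd (j i) then - s / 2 else s / 2)" for i b
  have one: "indicator (dyadic_interval (k + 1) (j i)) t
      = (\<Sum>b\<in>UNIV. c i b * haar_interval b (dyadic_interval k (p i)) t)" for i t
  proof -
    have "j i = (if odd (j i) then 2 * p i + 1 else 2 * p i)"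
      by (auto simp: p_def)
    moreover have "(\<Sum>b\<in>UNIV. c i b * haar_interval b (dyadic_interval k (p i)) t)
       = (if odd (j i) then indicator (dyadic_interval (k + 1) (2 * p i + 1)) t
          else indicator (dyadic_interval (k + 1) (2 * p i)) t)"
      using s indicator_dyadic_halves[of k "p i" t]
      by (simp add: UNIV_bool haar_dyadic s_def[symmetric] c_def field_simps)
    ultimately show ?thesis by metis
  qed
  have "indicator (dyadic_cube (k + 1) j) x =
    indicator (dyadic_cube k p) x / 2 ^ CARD('n) +
    (\<Sum>a\<in>signatures. (\<Prod>i\<in>UNIV. c i (a i)) * haar_cube a (dyadic_cube k p) x)" for x
  proof -
    have "indicator (dyadic_cube (k + 1) j) x
      = (\<Sum>a\<in>UNIV. (\<Prod>i\<in>UNIV. c i (a i)) * haar_cube a (dyadic_cube k p) x)"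
      unfolding indicator_dyadic_cube one haar_cube_dyadic prod.distrib[symmetric]
      by (subst prod_sum_PiE) (auto simp: PiE_UNIV_domain)
    also have "\<dots> = (\<Prod>i\<in>UNIV. c i False) * haar_cube (\<lambda>_. False) (dyadic_cube k p) x +
        (\<Sum>a\<in>signatures. (\<Prod>i\<in>UNIV. c i (a i)) * haar_cube a (dyadic_cube k p) x)"
      unfolding signatures_def by (rule sum.remove) auto
    also have "(\<Prod>i\<in>UNIV. c i False) * haar_cube (\<lambda>_. False) (dyadic_cube k p) x
       = indicator (dyadic_cube k p) x / 2 ^ CARD('n)"
      using s unfolding indicator_dyadic_cube haar_cube_dyadic prod.distrib[symmetric]
      by (simp add: haar_dyadic s_def[symmetric] c_def prod_dividef)
    finally show ?thesis .
  qed
  then show ?thesis by (intro exI[of _ "\<lambda>a. \<Prod>i\<in>UNIV. c i (a i)"]) blast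
qed

lemma dyadic_cube_sets [measurable]: "dyadic_cube k j \<in> sets borel"
  unfolding dyadic_cube_def by measurable

lemma integral_indicator_dyadic_cube:
  "(LINT x|lborel. indicat_real (dyadic_cube k (j :: 'n::finite \<Rightarrow> int)) x) = (2 powi - k) ^ CARD('n)"
  unfolding indicator_dyadic_cube
  by (subst integral_lborel_prod_vec) (auto simp: measure_dyadic_interval)

lemma integrable_indicator_dyadic_cube:
  "integrable lborel (indicat_real (dyadic_cube k (j :: 'n::finite \<Rightarrow> int)))"
  unfolding indicator_dyadic_cube
  by (rule integrable_lborel_prod_vec) simp

section \<open>Density of indicator functions\<close>

lemma integrable_indicator_L2:
  assumes "(indicator A :: 'a \<Rightarrow> complex) \<in> L2 M"
  shows "integrable M (indicat_real A)"
proof -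
  have "(cmod (indicator A x))\<^sup>2 = indicat_real A x" for x
    by (simp add: indicator_def)
  with L2_integrable_sq[OF assms] show ?thesis by simp
qed

context
  fixes M :: "'a measure" and V and G :: "'a set set" and Q :: "nat \<Rightarrow> 'a set"
  assumes V: "closed_subspace M V"
    and G: "Int_stable G" "G \<subseteq> Pow (space M)" "sets M = sigma_sets (space M) G"
    and Q: "range Q \<subseteq> G" "(\<Union>n. Q n) = space M"
    and ind: "\<And>A. A \<in> G \<Longrightarrow> (indicator A :: 'a \<Rightarrow> complex) \<in> V"
begin

text \<open>
  Intersecting with a fixed \<open>R \<in> G\<close> keeps all measures finite, so that complements can be taken relative
  to \<open>R\<close> and Dynkin's theorem applies although \<open>M\<close> may be an infinite measure.
\<close>

lemma indicator_Int_generator: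
  assumes "A \<in> sets M" "R \<in> G"
  shows "(indicator (A \<inter> R) :: 'a \<Rightarrow> complex) \<in> V"
proof -
  have R [measurable]: "R \<in> sets M"
    using assms(2) G(3) by (auto intro: sigma_sets.Basic)
  have "(indicat_real R x)\<^sup>2 = indicat_real R x" for x
    by (simp add: indicator_def)
  then have intR: "integrable M (\<lambda>x. (indicat_real R x)\<^sup>2)"
    using integrable_indicator_L2[OF closed_subspace_L2[OF V ind[OF assms(2)]]] by simp
  from G(1,2) assms(1)[unfolded G(3)] show ?thesis
  proof (induction rule: sigma_sets_induct_disjoint)
    case (basic A)
    then show ?case using G(1) assms(2) ind by (auto simp: Int_stable_def)
  next
    case empty
    then show ?case using closed_subspace_zero[OF V] by (simp add: indicator_def)
  next
    case (compl A)
    have "(indicator ((space M - A) \<inter> R) :: 'a \<Rightarrow> complex) = (\<lambda>x. indicator R x - indicator (A \<inter> R) x)"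
      using sets.sets_into_space[OF R] by (auto simp: fun_eq_iff indicator_def)
    then show ?case
      using closed_subspace_diff[OF V ind[OF assms(2)] compl.IH] by (simp only:)
  next
    case (union A)
    have [measurable]: "A i \<in> sets M" for i
      using union.hyps G(3) by auto
    have sum: "(\<Sum>i<n. indicator (A i \<inter> R) x) = (indicator (\<Union>i<n. A i \<inter> R) x :: complex)" for n x
      using union.hyps(1)
      by (intro indicator_UN_disjoint[symmetric]) (auto simp: disjoint_family_on_def)
    show ?case
    proof (rule closed_subspace_dominated_limit[OF V _ _ _ intR])
      show "(\<lambda>x. \<Sum>i<n. indicator (A i \<inter> R) x :: complex) \<in> V" for n
        by (intro closed_subspace_sum[OF V] union.IH)
      show "(\<lambda>n. \<Sum>i<n. indicator (A i \<inter> R) x :: complex) \<longlonglongrightarrow> indicator (\<Union> (range A) \<inter> R) x" for x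
      proof -
        have "\<Union> (range A) \<inter> R = (\<Union>i. A i \<inter> R)" by blast
        then show ?thesis unfolding sum by (simp only: LIMSEQ_indicator_UN)
      qed
      show "cmod (\<Sum>i<n. indicator (A i \<inter> R) x) \<le> indicat_real R x" for n x
        unfolding sum by (auto simp: indicator_def)
    qed measurable
  qed
qed

lemma indicator_Int_finite_Union:
  assumes "finite F" "F \<subseteq> G" "A \<in> sets M"
  shows "(indicator (A \<inter> \<Union>F) :: 'a \<Rightarrow> complex) \<in> V"
  using assms
proof (induction F arbitrary: A)
  case empty
  then show ?case using closed_subspace_zero[OF V] by (simp add: indicator_def)
next
  case (insert R F)
  have "R \<in> sets M"
    using insert.prems G(3) by (auto intro: sigma_sets.Basic)
  then have "(indicator ((A - R) \<inter> \<Union>F) :: 'a \<Rightarrow> complex) \<in> V" "(indicator (A \<inter> R) :: 'a \<Rightarrow> complex) \<in> V"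
    using insert by (auto intro: indicator_Int_generator)
  note closed_subspace_add[OF V this]
  moreover have "(indicator (A \<inter> \<Union>(insert R F)) :: 'a \<Rightarrow> complex)
      = (\<lambda>x. indicator ((A - R) \<inter> \<Union>F) x + indicator (A \<inter> R) x)"
    by (auto simp: fun_eq_iff indicator_def)
  ultimately show ?case by (simp only:)
qed

lemma indicator_finite_measure:
  assumes A: "integrable M (indicat_real A)" and [measurable]: "A \<in> sets M"
  shows "(indicator A :: 'a \<Rightarrow> complex) \<in> V"
proof (rule closed_subspace_dominated_limit[OF V])
  let ?U = "\<lambda>n. A \<inter> \<Union>(Q ` {..<n})"
  show "(indicator (?U n) :: 'a \<Rightarrow> complex) \<in> V" for n
    using Q(1) by (intro indicator_Int_finite_Union) auto
  have "(indicat_real A x)\<^sup>2 = indicat_real A x" for x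
    by (simp add: indicator_def)
  then show "integrable M (\<lambda>x. (indicat_real A x)\<^sup>2)"
    using A by simp
  show "(\<lambda>n. indicator (?U n) x :: complex) \<longlonglongrightarrow> indicator A x" if x: "x \<in> space M" for x
  proof -
    from x Q(2) obtain m where "x \<in> Q m" by auto
    then have "\<forall>\<^sub>F n in sequentially. indicator (?U n) x = (indicator A x :: complex)"
      by (intro eventually_sequentiallyI[of "Suc m"]) (auto simp: indicator_def)
    then show ?thesis by (rule tendsto_eventually)
  qed
qed (auto simp: indicator_def)

text \<open>
  Approximation by simple functions \<open>s i\<close> with \<open>\<bar>s i\<bar> \<le> 2 \<bar>f\<bar>\<close>. The bound makes every level set of a nonzero
  value have finite measure, by Chebyshev's inequality.
\<close>

lemma L2_subset_closed_subspace: "L2 M \<subseteq> V"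
proof
  fix f :: "'a \<Rightarrow> complex" assume f: "f \<in> L2 M"
  note [measurable] = L2_measurable[OF f]
  obtain s where s: "\<And>i. simple_function M (s i)"
      "\<And>x. x \<in> space M \<Longrightarrow> (\<lambda>i. s i x) \<longlonglongrightarrow> f x"
      "\<And>i x. x \<in> space M \<Longrightarrow> cmod (s i x) \<le> 2 * cmod (f x)"
    using borel_measurable_implies_sequence_metric[OF L2_measurable[OF f], of 0] by auto metis
  have w: "integrable M (\<lambda>x. (2 * cmod (f x))\<^sup>2)"
    using L2_integrable_sq[OF f] by (simp add: power_mult_distrib)
  have level: "(indicator (s i -` {y} \<inter> space M) :: 'a \<Rightarrow> complex) \<in> V" if "y \<noteq> 0" for i y
  proof (rule indicator_finite_measure)
    show meas [measurable]: "s i -` {y} \<inter> space M \<in> sets M"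
      by (rule simple_functionD[OF s(1)])
    have "integrable M (\<lambda>x. (2 * cmod (f x))\<^sup>2 / (cmod y)\<^sup>2)"
      using w by simp
    then show "integrable M (indicat_real (s i -` {y} \<inter> space M))"
    proof (rule Bochner_Integration.integrable_bound)
      show "AE x in M. norm (indicat_real (s i -` {y} \<inter> space M) x) \<le> norm ((2 * cmod (f x))\<^sup>2 / (cmod y)\<^sup>2)"
      proof (rule AE_I2)
        fix x assume x: "x \<in> space M"
        show "norm (indicat_real (s i -` {y} \<inter> space M) x) \<le> norm ((2 * cmod (f x))\<^sup>2 / (cmod y)\<^sup>2)"
        proof (cases "s i x = y")
          case True
          then have "(cmod y)\<^sup>2 \<le> (2 * cmod (f x))\<^sup>2"
            using s(3)[OF x, of i] by (intro power_mono) auto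
          then show ?thesis using that by (simp add: indicator_def True)
        qed (simp add: indicator_def)
      qed
    qed measurable
  qed
  define t where "t i x = (\<Sum>y\<in>s i ` space M - {0}. y * indicator (s i -` {y} \<inter> space M) x)" for i x
  have t: "t i x = s i x" if x: "x \<in> space M" for i x
  proof -
    have fin: "finite (s i ` space M)" using s(1) by (simp add: simple_function_def)
    have "t i x = (\<Sum>y\<in>s i ` space M - {0}. if s i x = y then s i x else 0)"
      unfolding t_def using x by (intro sum.cong) (auto simp: indicator_def)
    also have "\<dots> = s i x"
      using fin x by (auto simp: sum.delta')
    finally show ?thesis .
  qed
  show "f \<in> V"
  proof (rule closed_subspace_dominated_limit[OF V _ _ _ w])
    show "t i \<in> V" for i
      unfolding t_def by (intro closed_subspace_sum[OF V] closed_subspace_scale[OF V] level) auto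
  qed (use s t in auto)
qed

end

section \<open>Indicators of dyadic cubes from Haar functions\<close>

text \<open>
  Each passage from a cube to its parent costs a factor \<open>2 ^ -m\<close>, up to Haar functions. After \<open>N\<close> steps
  what remains of the indicator of \<open>I\<close> is \<open>2 ^ (- m N)\<close> times the indicator of an ancestor of volume
  \<open>2 ^ (m N)\<close> times that of \<open>I\<close>; its squared norm is of order \<open>2 ^ (- m N)\<close>. So although Haar functions
  have mean zero, they approximate indicators in L2.
\<close>

lemma closed_subspace_dyadic_cubes:
  fixes V :: "(real ^ 'n \<Rightarrow> complex) set"
  assumes V: "closed_subspace lborel V"
    and haar: "\<And>a I. a \<in> signatures \<Longrightarrow> I \<in> dyadic_cubes \<Longrightarrow> (\<lambda>x. of_real (haar_cube a I x)) \<in> V"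
    and "I \<in> dyadic_cubes"
  shows "(indicator I :: real ^ 'n \<Rightarrow> complex) \<in> V"
proof -
  from \<open>I \<in> dyadic_cubes\<close> obtain k j where I: "I = dyadic_cube k j"
    by (auto simp: dyadic_cubes_eq)
  let ?m = "CARD('n)"
  have "\<exists>p. (\<lambda>x. indicator I x - of_real ((1 / 2 ^ ?m) ^ N) * indicator (dyadic_cube (k - int N) p) x) \<in> V" for N
  proof (induction N)
    case 0
    show ?case using closed_subspace_zero[OF V] by (intro exI[of _ j]) (simp add: I)
  next
    case (Suc N)
    then obtain p where p: "(\<lambda>x. indicator I x - of_real ((1 / 2 ^ ?m) ^ N) * indicator (dyadic_cube (k - int N) p) x) \<in> V"
      by blast
    let ?C = "dyadic_cube (k - int (Suc N)) (\<lambda>i. p i div 2)"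
    have shift: "k - int (Suc N) + 1 = k - int N" by simp
    obtain c where c: "\<And>x. indicator (dyadic_cube (k - int N) p) x =
        indicator ?C x / 2 ^ ?m + (\<Sum>a\<in>signatures. c a * haar_cube a ?C x)"
      using indicator_dyadic_cube_refine[of "k - int (Suc N)" p, unfolded shift] by blast
    define S :: "real ^ 'n \<Rightarrow> complex" where "S x = (\<Sum>a\<in>signatures. of_real (c a) * of_real (haar_cube a ?C x))" for x
    define r :: complex where "r = of_real ((1 / 2 ^ ?m) ^ N)"
    have "(\<lambda>x. r * S x) \<in> V"
      unfolding S_def
      by (intro closed_subspace_scale[OF V] closed_subspace_sum[OF V] haar) (auto simp: dyadic_cubes_eq)
    note closed_subspace_add[OF V p[folded r_def] this]
    moreover have "(indicator (dyadic_cube (k - int N) p) x :: complex) = indicator ?C x / 2 ^ ?m + S x" for x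
    proof -
      have "(indicator (dyadic_cube (k - int N) p) x :: complex) = of_real (indicator (dyadic_cube (k - int N) p) x)"
        by (simp add: indicator_def)
      also have "\<dots> = indicator ?C x / 2 ^ ?m + S x"
        unfolding c S_def by (simp add: indicator_def)
      finally show ?thesis .
    qed
    then have "(\<lambda>x. indicator I x - r * indicator (dyadic_cube (k - int N) p) x + r * S x)
        = (\<lambda>x. indicator I x - of_real ((1 / 2 ^ ?m) ^ Suc N) * indicator ?C x)"
      by (simp add: ring_distribs r_def)
    ultimately show ?case by (intro exI[of _ "\<lambda>i. p i div 2"]) (simp only:)
  qed
  then have "\<forall>N. \<exists>p. (\<lambda>x. indicator I x - of_real ((1 / 2 ^ ?m) ^ N) * indicator (dyadic_cube (k - int N) p) x) \<in> V"
    by blast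
  from choice[OF this] obtain p where p: "\<And>N. (\<lambda>x. indicator I x - of_real ((1 / 2 ^ ?m) ^ N) * indicator (dyadic_cube (k - int N) (p N)) x) \<in> V"
    by blast
  have sq: "L2_sq lborel (indicator (dyadic_cube l q) :: real ^ 'n \<Rightarrow> complex) = (2 powi - l) ^ ?m" for l q
  proof -
    have "(cmod (indicator (dyadic_cube l q) x))\<^sup>2 = indicat_real (dyadic_cube l q) x" for x :: "real ^ 'n"
      by (simp add: indicator_def)
    then show ?thesis
      by (simp only: L2_sq_def integral_indicator_dyadic_cube)
  qed
  show ?thesis
  proof (rule closed_subspace_limit_seq[OF V _ p])
    have "(cmod (indicator I x))\<^sup>2 = indicat_real I x" for x :: "real ^ 'n"
      by (simp add: indicator_def)
    then show "(indicator I :: real ^ 'n \<Rightarrow> complex) \<in> L2 lborel"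
      by (simp add: L2_def I integrable_indicator_dyadic_cube)
    have "((1 / 2 ^ ?m) ^ N)\<^sup>2 * (2 powi - (k - int N)) ^ ?m = (2 powi - k) ^ ?m * (1 / 2 ^ ?m :: real) ^ N" for N
    proof -
      have "(2::real) powi - (k - int N) = 2 powi (- k + int N)"
        by (simp add: algebra_simps)
      also have "\<dots> = 2 powi - k * 2 ^ N"
        by (subst power_int_add) auto
      finally have "(2 powi - (k - int N)) ^ ?m = (2 powi - k) ^ ?m * ((2::real) ^ ?m) ^ N"
        by (simp add: power_mult_distrib power_mult[symmetric] mult.commute)
      moreover have "((1 / 2 ^ ?m :: real) ^ N)\<^sup>2 * (y * (2 ^ ?m) ^ N) = y * (1 / 2 ^ ?m) ^ N" for y
        by (simp add: power_divide power2_eq_square)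
      ultimately show ?thesis by (simp only:)
    qed
    then have "L2_sq lborel (\<lambda>x. indicator I x - (indicator I x - of_real ((1 / 2 ^ ?m) ^ N) *
        indicator (dyadic_cube (k - int N) (p N)) x :: complex)) = (2 powi - k) ^ ?m * (1 / 2 ^ ?m) ^ N" for N
      by (simp add: L2_sq_scale sq norm_power norm_divide)
    moreover have "(\<lambda>N. (2 powi - k) ^ ?m * (1 / 2 ^ ?m :: real) ^ N) \<longlonglongrightarrow> (2 powi - k) ^ ?m * 0"
      by (intro tendsto_intros LIMSEQ_power_zero) (simp add: norm_divide norm_power one_less_power)
    ultimately show "(\<lambda>N. L2_sq lborel (\<lambda>x. indicator I x - (indicator I x - of_real ((1 / 2 ^ ?m) ^ N) *
        indicator (dyadic_cube (k - int N) (p N)) x :: complex))) \<longlonglongrightarrow> 0"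
      by simp
  qed
qed

section \<open>Tensor products and bounded linear maps\<close>

definition tensor :: "('a \<Rightarrow> complex) \<Rightarrow> ('b \<Rightarrow> complex) \<Rightarrow> 'a \<times> 'b \<Rightarrow> complex" where
  "tensor u v x = u (fst x) * v (snd x)"

lemma (in pair_sigma_finite)
  fixes f g :: "_ \<Rightarrow> _::{real_normed_field, banach, second_countable_topology}"
  assumes f: "integrable M1 f" and g: "integrable M2 g"
  shows integrable_pair_product: "integrable (M1 \<Otimes>\<^sub>M M2) (\<lambda>x. f (fst x) * g (snd x))"
    and integral_pair_product:
      "(LINT x|(M1 \<Otimes>\<^sub>M M2). f (fst x) * g (snd x)) = (LINT x|M1. f x) * (LINT y|M2. g y)"
proof -
  have [measurable]: "f \<in> borel_measurable M1" "g \<in> borel_measurable M2"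
    using f g by auto
  show int: "integrable (M1 \<Otimes>\<^sub>M M2) (\<lambda>x. f (fst x) * g (snd x))"
    by (rule Fubini_integrable) (use f g in \<open>auto simp: norm_mult\<close>)
  show "(LINT x|(M1 \<Otimes>\<^sub>M M2). f (fst x) * g (snd x)) = (LINT x|M1. f x) * (LINT y|M2. g y)"
    using integral_fst'[OF int] by simp
qed

lemmas integrable_lborel_pair_product = lborel_pair.integrable_pair_product[unfolded lborel_prod]
lemmas integral_lborel_pair_product = lborel_pair.integral_pair_product[unfolded lborel_prod]

lemma
  assumes u: "u \<in> L2 lborel" and v: "v \<in> L2 lborel"
  shows tensor_L2: "tensor u v \<in> L2 lborel"
    and L2_sq_tensor: "L2_sq lborel (tensor u v) = L2_sq lborel u * L2_sq lborel v"
proof -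
  have eq: "(cmod (tensor u v x))\<^sup>2 = (cmod (u (fst x)))\<^sup>2 * (cmod (v (snd x)))\<^sup>2" for x
    by (simp add: tensor_def norm_mult power_mult_distrib)
  note [measurable] = L2_measurable[OF u] L2_measurable[OF v]
  have "tensor u v \<in> borel_measurable (lborel \<Otimes>\<^sub>M lborel)"
    unfolding tensor_def by measurable
  then show "tensor u v \<in> L2 lborel"
    unfolding L2_def mem_Collect_eq eq using integrable_lborel_pair_product[OF u[THEN L2_integrable_sq] v[THEN L2_integrable_sq]]
    by (simp only: lborel_prod simp_thms)
  show "L2_sq lborel (tensor u v) = L2_sq lborel u * L2_sq lborel v"
    unfolding L2_sq_def eq by (rule integral_lborel_pair_product) (intro L2_integrable_sq u v)+
qed

text \<open>
  Since \<open>L\<close> is linear and bounded, approximations \<open>g\<close> of \<open>f\<close> give approximations \<open>L g\<close> of \<open>L f\<close>. The instances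
  that matter are \<open>u \<mapsto> u \<otimes> v\<close>, \<open>v \<mapsto> u \<otimes> v\<close> and \<open>f \<mapsto> f \<circ> T\<close> with \<open>T\<close> measure preserving.
\<close>

lemma closed_subspace_vimage:
  assumes V: "closed_subspace N V"
    and L2: "\<And>f. f \<in> L2 M \<Longrightarrow> L f \<in> L2 N"
    and add: "\<And>f g. L (\<lambda>x. f x + g x) = (\<lambda>y. L f y + L g y)"
    and scale: "\<And>c f. L (\<lambda>x. c * f x) = (\<lambda>y. c * L f y)"
    and bound: "\<And>f. f \<in> L2 M \<Longrightarrow> L2_sq N (L f) \<le> K * L2_sq M f"
  shows "closed_subspace M {f \<in> L2 M. L f \<in> V}"
proof (rule closed_subspaceI)
  have "L (\<lambda>x. 0) = (\<lambda>y. 0)" using scale[of 0] by simp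
  then show "(\<lambda>_. 0) \<in> {f \<in> L2 M. L f \<in> V}"
    using closed_subspace_zero[OF V] by (simp add: L2_zero)
  show "(\<lambda>x. f x + g x) \<in> {f \<in> L2 M. L f \<in> V}"
    if "f \<in> {f \<in> L2 M. L f \<in> V}" "g \<in> {f \<in> L2 M. L f \<in> V}" for f g
    using that by (simp add: L2_add add closed_subspace_add[OF V])
  show "(\<lambda>x. c * f x) \<in> {f \<in> L2 M. L f \<in> V}" if "f \<in> {f \<in> L2 M. L f \<in> V}" for c f
    using that by (simp add: L2_scale scale closed_subspace_scale[OF V])
  fix f assume f: "f \<in> L2 M"
    and lim: "\<And>e. e > 0 \<Longrightarrow> \<exists>g\<in>{f \<in> L2 M. L f \<in> V}. L2_sq M (\<lambda>x. f x - g x) < e"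
  have "L f \<in> V"
  proof (rule closed_subspace_limit[OF V L2[OF f]])
    fix e :: real assume "e > 0"
    \<comment> \<open>The constant \<open>K\<close> may be zero, hence the denominator \<open>\<bar>K\<bar> + 1\<close>.\<close>
    then have "e / (\<bar>K\<bar> + 1) > 0" by (simp add: add_nonneg_pos)
    from lim[OF this] obtain g where g: "g \<in> L2 M" "L g \<in> V"
        "L2_sq M (\<lambda>x. f x - g x) < e / (\<bar>K\<bar> + 1)"
      by blast
    have "L2_sq N (\<lambda>y. L f y - L g y) = L2_sq N (L (\<lambda>x. f x - g x))"
      using add[of f "\<lambda>x. - 1 * g x"] scale[of "- 1" g] by simp
    also have "\<dots> \<le> K * L2_sq M (\<lambda>x. f x - g x)"
      by (intro bound L2_diff f g)
    also have "\<dots> \<le> (\<bar>K\<bar> + 1) * L2_sq M (\<lambda>x. f x - g x)"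
      by (intro mult_right_mono L2_sq_nonneg) simp
    also have "\<dots> < e"
      using g(3) by (simp add: pos_less_divide_eq add_nonneg_pos mult.commute)
    finally show "\<exists>h\<in>V. L2_sq N (\<lambda>y. L f y - h y) < e"
      using g(2) by blast
  qed
  with f show "f \<in> {f \<in> L2 M. L f \<in> V}" by simp
qed auto

lemma closed_subspace_tensor_left:
  assumes V: "closed_subspace lborel V" and v: "v \<in> L2 lborel"
  shows "closed_subspace lborel {u \<in> L2 lborel. tensor u v \<in> V}"
  by (rule closed_subspace_vimage[OF V, where K = "L2_sq lborel v"])
    (simp_all add: v tensor_L2 L2_sq_tensor, simp_all add: tensor_def fun_eq_iff algebra_simps)

lemma closed_subspace_tensor_right:
  assumes V: "closed_subspace lborel V" and u: "u \<in> L2 lborel"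
  shows "closed_subspace lborel {v \<in> L2 lborel. tensor u v \<in> V}"
  by (rule closed_subspace_vimage[OF V, where K = "L2_sq lborel u"])
    (simp_all add: u tensor_L2 L2_sq_tensor, simp_all add: tensor_def fun_eq_iff algebra_simps)

context
  fixes N :: "'a measure" and M :: "'b measure" and T
  assumes T [measurable]: "T \<in> measurable N M" and distr: "distr N M T = M"
begin

lemma L2_sq_comp:
  assumes [measurable]: "f \<in> borel_measurable M"
  shows "L2_sq N (f \<circ> T) = L2_sq M f"
proof -
  have "L2_sq M f = L2_sq (distr N M T) f" by (simp only: distr)
  also have "\<dots> = L2_sq N (f \<circ> T)"
    unfolding L2_sq_def by (subst integral_distr) (auto simp: comp_def)
  finally show ?thesis by simp
qed

lemma L2_comp:
  assumes f: "f \<in> L2 M"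
  shows "f \<circ> T \<in> L2 N"
proof -
  note [measurable] = L2_measurable[OF f]
  have "integrable (distr N M T) (\<lambda>x. (cmod (f x))\<^sup>2)"
    unfolding distr by (rule L2_integrable_sq[OF f])
  then have "integrable N (\<lambda>x. (cmod (f (T x)))\<^sup>2)"
    by (subst (asm) integrable_distr_eq) auto
  then show ?thesis
    by (simp add: L2_def measurable_comp[OF T L2_measurable[OF f]])
qed

lemma L2_inner_comp:
  assumes "f \<in> L2 M" "g \<in> L2 M"
  shows "L2_inner N (f \<circ> T) (g \<circ> T) = L2_inner M f g"
proof -
  have "L2_inner M f g = L2_inner (distr N M T) f g"
    by (simp only: distr)
  also have "\<dots> = L2_inner N (f \<circ> T) (g \<circ> T)"
    unfolding L2_inner_def
    using borel_measurable_integrable[OF integrable_L2_inner[OF assms]]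
    by (subst integral_distr[OF T]) auto
  finally show ?thesis by simp
qed

lemma closed_subspace_pullback:
  assumes V: "closed_subspace N V"
  shows "closed_subspace M {f \<in> L2 M. f \<circ> T \<in> V}"
  by (rule closed_subspace_vimage[OF V, where K = 1])
    (simp_all add: L2_comp L2_sq_comp L2_measurable fun_eq_iff)

end

section \<open>Dyadic rectangles span L2\<close>

lemma dyadic_cubes_Int:
  fixes I J :: "(real ^ 'n) set"
  assumes "I \<in> dyadic_cubes" "J \<in> dyadic_cubes"
  shows "I \<inter> J \<in> insert {} dyadic_cubes"
proof -
  have *: "dyadic_cube k u \<inter> dyadic_cube l v \<in> insert {} dyadic_cubes"
    if "k \<le> l" for k l and u v :: "'n \<Rightarrow> int"
  proof -
    have "x \<in> dyadic_cube k u \<longleftrightarrow> (\<forall>i. v i div 2 ^ nat (l - k) = u i)" if "x \<in> dyadic_cube l v" for x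
    proof -
      have "x $ i \<in> dyadic_interval l (v i)" for i
        using that by (simp add: dyadic_cube_def)
      note dyadic_interval_refine[OF \<open>k \<le> l\<close> this]
      then show ?thesis by (simp add: dyadic_cube_def)
    qed
    then have "dyadic_cube k u \<inter> dyadic_cube l v = {} \<or> dyadic_cube k u \<inter> dyadic_cube l v = dyadic_cube l v"
      by blast
    then show ?thesis by (auto simp: dyadic_cubes_eq)
  qed
  from assms obtain k u l v where "I = dyadic_cube k u" "J = dyadic_cube l v"
    by (auto simp: dyadic_cubes_eq)
  then show ?thesis
    using *[of k l u v] *[of l k v u] by (cases "k \<le> l") (auto simp: Int_commute)
qed

lemma countable_dyadic_cubes: "countable (dyadic_cubes :: (real ^ 'n) set set)"
proof -
  have "dyadic_cubes = range (\<lambda>(k, j). dyadic_cube k j :: (real ^ 'n) set)"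
    by (auto simp: dyadic_cubes_eq)
  moreover have "countable (range (\<lambda>(k, j). dyadic_cube k j :: (real ^ 'n) set))"
    by (rule countable_image) (rule countableI_type)
  ultimately show ?thesis by (simp only:)
qed

lemma dyadic_cube_in_open:
  fixes A :: "(real ^ 'n) set"
  assumes "open A" "x \<in> A"
  shows "\<exists>I\<in>dyadic_cubes. x \<in> I \<and> I \<subseteq> A"
proof -
  obtain e where e: "e > 0" "ball x e \<subseteq> A"
    using assms by (auto simp: open_contains_ball)
  obtain k :: nat where k: "(1 / 2) ^ k < e / CARD('n)"
    using real_arch_pow_inv[of "e / CARD('n)" "1 / 2"] e by auto
  define I where "I = dyadic_cube (int k) (\<lambda>i. \<lfloor>x $ i * 2 powi int k\<rfloor>)"
  have "x \<in> I" by (simp add: I_def dyadic_cube_def dyadic_interval_iff)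
  moreover have "I \<subseteq> A"
  proof
    fix y assume "y \<in> I"
    have "norm (x $ i - y $ i) \<le> (1 / 2) ^ k" for i
    proof -
      have "\<lfloor>x $ i * 2 ^ k\<rfloor> = \<lfloor>y $ i * 2 ^ k\<rfloor>"
        using \<open>x \<in> I\<close> \<open>y \<in> I\<close> by (simp add: I_def dyadic_cube_def dyadic_interval_iff)
      then have "\<bar>x $ i * 2 ^ k - y $ i * 2 ^ k\<bar> \<le> 1" by linarith
      then have "\<bar>x $ i - y $ i\<bar> * 2 ^ k \<le> 1"
        by (simp add: left_diff_distrib[symmetric] abs_mult)
      then show ?thesis by (simp add: power_divide pos_le_divide_eq)
    qed
    then have "(\<Sum>i\<in>UNIV. norm ((x - y) $ i)) \<le> (\<Sum>i\<in>(UNIV :: 'n set). (1 / 2) ^ k)"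
      by (intro sum_mono) simp
    also have "\<dots> < e"
      using k by (simp add: pos_less_divide_eq mult.commute)
    finally have "dist x y < e"
      using norm_le_l1_cart[of "x - y"] by (simp add: dist_norm)
    then show "y \<in> A" using e by auto
  qed
  ultimately show ?thesis by (auto simp: I_def dyadic_cubes_eq)
qed

text \<open>
  Products of two dyadic cubes form, together with the empty set, a countable family that is stable
  under intersection. Every open set is the union of the rectangles it contains, so the family generates
  the Borel sets.
\<close>

lemma closed_subspace_dyadic_rectangles:
  fixes V :: "((real ^ 'n) \<times> (real ^ 'n) \<Rightarrow> complex) set"
  assumes V: "closed_subspace lborel V"
    and ind: "\<And>I J. I \<in> dyadic_cubes \<Longrightarrow> J \<in> dyadic_cubes \<Longrightarrow> tensor (indicator I) (indicator J) \<in> V"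
  shows "L2 lborel \<subseteq> V"
proof -
  define R :: "((real ^ 'n) \<times> (real ^ 'n)) set set"
    where "R = (\<lambda>(I, J). I \<times> J) ` (dyadic_cubes \<times> dyadic_cubes)"
  have countR: "countable R"
    unfolding R_def by (intro countable_image countable_SIGMA countable_dyadic_cubes)
  have in_open: "\<exists>Q\<in>R. x \<in> Q \<and> Q \<subseteq> U" if "open U" "x \<in> U" for x U
  proof -
    from that obtain A B where AB: "open A" "open B" "x \<in> A \<times> B" "A \<times> B \<subseteq> U"
      by (rule open_prod_elim)
    then obtain I J where "I \<in> dyadic_cubes" "fst x \<in> I" "I \<subseteq> A" "J \<in> dyadic_cubes" "snd x \<in> J" "J \<subseteq> B"
      using dyadic_cube_in_open[of A "fst x"] dyadic_cube_in_open[of B "snd x"] by (auto simp: mem_Times_iff)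
    with AB(4) show ?thesis
      by (intro bexI[of _ "I \<times> J"]) (auto simp: R_def mem_Times_iff)
  qed
  have Rne: "R \<noteq> {}"
    using in_open[of UNIV undefined] by auto
  have gen: "sets lborel = sigma_sets UNIV (insert {} R)"
  proof -
    have "sigma_sets UNIV (insert {} R) \<subseteq> sets borel"
    proof (rule sets.sigma_sets_subset[of _ borel, simplified space_borel])
      show "insert {} R \<subseteq> sets borel"
        by (auto simp: R_def dyadic_cubes_eq intro!: borel_Times)
    qed
    moreover have "sigma_sets UNIV {S. open S} \<subseteq> sigma_sets UNIV (insert {} R)"
    proof (rule sigma_sets_mono, rule subsetI)
      fix U :: "((real ^ 'n) \<times> (real ^ 'n)) set"
      assume "U \<in> {S. open S}"
      then have "U = \<Union>{Q \<in> R. Q \<subseteq> U}"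
        using in_open by blast
      also have "\<dots> \<in> sigma_sets UNIV (insert {} R)"
        using countR by (intro sigma_sets_UNION countable_subset[OF _ countR]) (auto intro: sigma_sets.Basic)
      finally show "U \<in> sigma_sets UNIV (insert {} R)" .
    qed
    ultimately show ?thesis by (auto simp: borel_def)
  qed
  show ?thesis
  proof (rule L2_subset_closed_subspace[OF V, of "insert {} R" "from_nat_into R"])
    show "Int_stable (insert {} R)"
    proof (rule Int_stableI)
      fix P Q assume "P \<in> insert {} R" "Q \<in> insert {} R"
      then consider "P \<inter> Q = {}" | I J I' J' where "P = I \<times> J" "Q = I' \<times> J'"
          "I \<in> dyadic_cubes" "J \<in> dyadic_cubes" "I' \<in> dyadic_cubes" "J' \<in> dyadic_cubes"
        by (auto simp: R_def)
      then show "P \<inter> Q \<in> insert {} R"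
      proof cases
        case 2
        then have "P \<inter> Q = (I \<inter> I') \<times> (J \<inter> J')" by blast
        then show ?thesis
          using dyadic_cubes_Int[OF 2(3,5)] dyadic_cubes_Int[OF 2(4,6)] by (auto simp: R_def)
      qed simp
    qed
    show "range (from_nat_into R) \<subseteq> insert {} R"
      using from_nat_into[OF Rne] by auto
    have "\<Union>R = UNIV" using in_open[of UNIV] by auto
    then show "(\<Union>n. from_nat_into R n) = space lborel"
      by (simp add: range_from_nat_into[OF Rne countR])
    fix A assume "A \<in> insert {} R"
    then consider "A = {}" | I J where "A = I \<times> J" "I \<in> dyadic_cubes" "J \<in> dyadic_cubes"
      by (auto simp: R_def)
    then show "(indicator A :: _ \<Rightarrow> complex) \<in> V"
    proof cases
      case 1
      then have "(indicator A :: _ \<Rightarrow> complex) = (\<lambda>x. 0)" by (simp add: fun_eq_iff)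
      then show ?thesis using closed_subspace_zero[OF V] by (simp only:)
    next
      case 2
      have "indicator A = tensor (indicator I) (indicator J)"
        by (auto simp: 2 fun_eq_iff tensor_def indicator_def)
      then show ?thesis using ind[OF 2(2,3)] by simp
    qed
  qed (use gen in auto)
qed

section \<open>From Borel to Lebesgue measurable functions\<close>

lemma L2_completion_borel_representative:
  assumes f: "f \<in> L2 (completion M)"
  obtains g where "g \<in> L2 M" "AE x in completion M. f x = g x"
proof -
  note [measurable] = L2_measurable[OF f]
  have "(\<lambda>x. Re (f x)) \<in> borel_measurable (completion M)" "(\<lambda>x. Im (f x)) \<in> borel_measurable (completion M)"
    by measurable
  from this[THEN completion_ex_borel_measurable_real] obtain r i
    where [measurable]: "r \<in> borel_measurable M" "i \<in> borel_measurable M"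
      and ae: "AE x in M. Re (f x) = r x" "AE x in M. Im (f x) = i x"
    by auto
  define g where "g x = complex_of_real (r x) + \<i> * complex_of_real (i x)" for x
  have gM [measurable]: "g \<in> borel_measurable M"
    unfolding g_def by measurable
  have "AE x in M. f x = g x"
    using ae by eventually_elim (simp add: g_def complex_eq_iff)
  then have eq: "AE x in completion M. f x = g x"
    by (rule AE_completion)
  have [measurable]: "g \<in> borel_measurable (completion M)"
    by (rule measurable_completion[OF gM])
  have "integrable (completion M) (\<lambda>x. (cmod (g x))\<^sup>2)"
    by (rule integrable_cong_AE_imp[OF L2_integrable_sq[OF f]]) (use eq in \<open>auto elim: eventually_mono\<close>)
  then have "integrable M (\<lambda>x. (cmod (g x))\<^sup>2)"
    by (subst (asm) integrable_completion) auto
  then show ?thesis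
    using that[of g] eq by (simp add: L2_def gM)
qed

text \<open>
  Every \<open>f\<close> in L2 of the completion has a representative in L2 of \<open>M\<close> at distance zero, and a closed
  subspace contains whatever is at distance zero from one of its members.
\<close>

lemma closed_subspace_completion:
  assumes V: "closed_subspace (completion M) V" and "L2 M \<subseteq> V"
  shows "L2 (completion M) \<subseteq> V"
proof
  fix f assume f: "f \<in> L2 (completion M)"
  then obtain g where g: "g \<in> L2 M" "AE x in completion M. f x = g x"
    by (rule L2_completion_borel_representative)
  have "g \<in> V" using g(1) assms(2) by blast
  note [measurable] = L2_measurable[OF f] L2_measurable[OF closed_subspace_L2[OF V this]]
  have "L2_sq (completion M) (\<lambda>x. f x - g x) = (LINT x|completion M. 0)"
    unfolding L2_sq_def by (rule integral_cong_AE) (use g(2) in \<open>auto elim: eventually_mono\<close>)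
  then show "f \<in> V"
    using \<open>g \<in> V\<close> by (intro closed_subspace_limit[OF V f] bexI[of _ g]) auto
qed

section \<open>Shears preserve Lebesgue measure\<close>

lemma nn_integral_lborel_translate:
  fixes c :: "'a::euclidean_space"
  assumes [measurable]: "f \<in> borel_measurable borel"
  shows "(\<integral>\<^sup>+x. f (x - c) \<partial>lborel) = (\<integral>\<^sup>+x. f x \<partial>lborel)"
proof -
  have "(\<integral>\<^sup>+x. f x \<partial>lborel) = (\<integral>\<^sup>+x. f x \<partial>distr lborel borel ((+) (- c)))"
    by (simp only: lborel_distr_plus)
  also have "\<dots> = (\<integral>\<^sup>+x. f (x - c) \<partial>lborel)"
    by (subst nn_integral_distr) auto
  finally show ?thesis by simp
qed

lemma shear_measurable [measurable]: "shear i \<in> borel_measurable borel"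
proof -
  have "continuous_on UNIV (shear i)"
    by (auto simp: shear_def case_prod_unfold intro!: continuous_intros)
  then show ?thesis by (rule borel_measurable_continuous_onI)
qed

text \<open>
  By Tonelli, integrating first in the sheared variable, in which the shear is a translation.
\<close>

lemma distr_shear: "distr lborel borel (shear i) = (lborel :: ((real ^ 'n) \<times> (real ^ 'n)) measure)"
proof (rule measure_eqI)
  fix A :: "((real ^ 'n) \<times> (real ^ 'n)) set"
  assume "A \<in> sets (distr lborel borel (shear i))"
  then have A [measurable]: "A \<in> sets borel" by simp
  have meas: "(\<lambda>x. indicator A (shear i x) :: ennreal) \<in> borel_measurable (lborel \<Otimes>\<^sub>M lborel)"
    "(indicator A :: _ \<Rightarrow> ennreal) \<in> borel_measurable (lborel \<Otimes>\<^sub>M lborel)"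
    unfolding lborel_prod by measurable
  have slice: "(\<lambda>x. indicator A (x, y) :: ennreal) \<in> borel_measurable borel"
    "(\<lambda>x. indicator A (y, x) :: ennreal) \<in> borel_measurable borel" for y
    by measurable
  have "emeasure (distr lborel borel (shear i)) A = (\<integral>\<^sup>+x. indicator A (shear i x) \<partial>(lborel \<Otimes>\<^sub>M lborel))"
  proof -
    have "emeasure (distr lborel borel (shear i)) A = (\<integral>\<^sup>+x. indicator A x \<partial>distr lborel borel (shear i))"
      by simp
    also have "\<dots> = (\<integral>\<^sup>+x. indicator A (shear i x) \<partial>lborel)"
      by (rule nn_integral_distr) auto
    finally show ?thesis by (simp only: lborel_prod)
  qed
  also have "\<dots> = (\<integral>\<^sup>+x. indicator A x \<partial>(lborel \<Otimes>\<^sub>M lborel))"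
  proof -
    consider "i = 2" | "i = 3" | "i \<noteq> 2" "i \<noteq> 3" by blast
    then show ?thesis
    proof cases
      case 1
      have "(\<integral>\<^sup>+x. indicator A (shear i x) \<partial>(lborel \<Otimes>\<^sub>M lborel))
          = (\<integral>\<^sup>+y. \<integral>\<^sup>+x. indicator A (x - y, y) \<partial>lborel \<partial>lborel)"
        by (subst lborel_pair.nn_integral_snd[OF meas(1), symmetric]) (simp add: 1 shear_def)
      also have "\<dots> = (\<integral>\<^sup>+y. \<integral>\<^sup>+x. indicator A (x, y) \<partial>lborel \<partial>lborel)"
        by (intro nn_integral_cong nn_integral_lborel_translate slice(1))
      also have "\<dots> = (\<integral>\<^sup>+x. indicator A x \<partial>(lborel \<Otimes>\<^sub>M lborel))"
        by (rule lborel_pair.nn_integral_snd[OF meas(2)])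
      finally show ?thesis .
    next
      case 2
      have "(\<integral>\<^sup>+x. indicator A (shear i x) \<partial>(lborel \<Otimes>\<^sub>M lborel))
          = (\<integral>\<^sup>+x. \<integral>\<^sup>+y. indicator A (x, y - x) \<partial>lborel \<partial>lborel)"
        by (subst lborel.nn_integral_fst[OF meas(1), symmetric]) (simp add: 2 shear_def)
      also have "\<dots> = (\<integral>\<^sup>+x. \<integral>\<^sup>+y. indicator A (x, y) \<partial>lborel \<partial>lborel)"
        by (intro nn_integral_cong nn_integral_lborel_translate slice(2))
      also have "\<dots> = (\<integral>\<^sup>+x. indicator A x \<partial>(lborel \<Otimes>\<^sub>M lborel))"
        by (rule lborel.nn_integral_fst[OF meas(2)])
      finally show ?thesis .
    qed (simp add: shear_def)
  qed
  also have "\<dots> = emeasure lborel A"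
    unfolding lborel_prod by simp
  finally show "emeasure (distr lborel borel (shear i)) A = emeasure lborel A" .
qed simp

text \<open>
  The inverse of a shear preserves measure because the shear does: pushing Lebesgue measure forward
  along both gives the image under the identity.
\<close>

lemma L2_comp_shear:
  fixes f :: "(real ^ 'n) \<times> (real ^ 'n) \<Rightarrow> complex"
  assumes f: "f \<in> L2 lborel"
  obtains g where "g \<in> L2 lborel" "f = g \<circ> shear i"
proof -
  define S :: "(real ^ 'n) \<times> (real ^ 'n) \<Rightarrow> (real ^ 'n) \<times> (real ^ 'n)"
    where "S = (if i = 2 then (\<lambda>(x, y). (x + y, y)) else if i = 3 then (\<lambda>(x, y). (x, y + x)) else id)"
  have inv: "S \<circ> shear i = id"
    by (auto simp: S_def shear_def fun_eq_iff)
  have "continuous_on UNIV S"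
    by (auto simp: S_def case_prod_unfold intro!: continuous_intros)
  then have S [measurable]: "S \<in> borel_measurable borel"
    by (rule borel_measurable_continuous_onI)
  have "distr lborel borel S = distr (distr lborel borel (shear i)) borel S"
    by (simp only: distr_shear)
  also have "\<dots> = distr lborel borel (S \<circ> shear i)"
    by (rule distr_distr) auto
  also have "\<dots> = lborel"
    unfolding inv by (rule measure_eqI) (auto simp: emeasure_distr)
  finally have "distr lborel lborel S = lborel"
    by (metis distr_cong sets_lborel)
  then have "f \<circ> S \<in> L2 lborel"
    using f S by (intro L2_comp) auto
  moreover have "f = (f \<circ> S) \<circ> shear i"
    by (simp add: comp_assoc inv)
  ultimately show ?thesis using that by blast
qed

section \<open>The tube Haar systems are orthonormal bases\<close>

abbreviation complex_haar_cube :: "('n \<Rightarrow> bool) \<Rightarrow> (real ^ 'n) set \<Rightarrow> real ^ 'n \<Rightarrow> complex" where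
  "complex_haar_cube a I \<equiv> (\<lambda>x. complex_of_real (haar_cube a I x))"

lemma haar_cube_L2:
  assumes "I \<in> dyadic_cubes"
  shows "complex_haar_cube a I \<in> L2 lborel"
proof -
  obtain k j where I: "I = dyadic_cube k j" using assms by (auto simp: dyadic_cubes_eq)
  show ?thesis
    using integrable_haar_cube_mult[of a k j a k j] by (simp add: L2_def I power2_eq_square)
qed

lemma haar_cube_L2_inner:
  assumes "I \<in> dyadic_cubes" "J \<in> dyadic_cubes" "a \<in> signatures" "b \<in> signatures"
  shows "L2_inner lborel (complex_haar_cube a I) (complex_haar_cube b J) = of_bool (I = J \<and> a = b)"
proof -
  have "L2_inner lborel (complex_haar_cube a I) (complex_haar_cube b J)
      = complex_of_real (LINT x|lborel. haar_cube a I x * haar_cube b J x)"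
    by (simp add: L2_inner_def flip: of_real_mult)
  then show ?thesis by (simp add: haar_cube_orthonormal[OF assms])
qed

lemma L2_inner_tensor:
  assumes "u \<in> L2 lborel" "u' \<in> L2 lborel" "v \<in> L2 lborel" "v' \<in> L2 lborel"
  shows "L2_inner lborel (tensor u v) (tensor u' v') = L2_inner lborel u u' * L2_inner lborel v v'"
proof -
  have "tensor u v x * cnj (tensor u' v' x) = (u (fst x) * cnj (u' (fst x))) * (v (snd x) * cnj (v' (snd x)))" for x
    by (simp add: tensor_def)
  then show ?thesis
    unfolding L2_inner_def
    using integral_lborel_pair_product[OF integrable_L2_inner[OF assms(1,2)] integrable_L2_inner[OF assms(3,4)]]
    by simp
qed

definition tube_indices_of :: "nat \<Rightarrow> (nat \<times> ((real ^ 'n) \<times> (real ^ 'n)) set \<times> ('n \<Rightarrow> bool) \<times> ('n \<Rightarrow> bool)) set" where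
  "tube_indices_of i = {i} \<times> (tubes i \<times> (signatures \<times> signatures))"

lemma tube_indices_ofE:
  assumes "p \<in> tube_indices_of i"
  obtains I J a b where "I \<in> dyadic_cubes" "J \<in> dyadic_cubes" "a \<in> signatures" "b \<in> signatures"
    "p = (i, shear i -` (I \<times> J), a, b)"
  using assms by (auto simp: tube_indices_of_def tubes_def)

lemma tube_family_eq:
  assumes "I \<in> dyadic_cubes" "J \<in> dyadic_cubes"
  shows "tube_family (i, shear i -` (I \<times> J), a, b) = tensor (complex_haar_cube a I) (complex_haar_cube b J) \<circ> shear i"
  by (simp add: tube_family_def haar_tube_eq[OF assms] fun_eq_iff haar_rect_def tensor_def)

lemma tube_eq_iff:
  assumes "I \<in> dyadic_cubes" "J \<in> dyadic_cubes" "I' \<in> dyadic_cubes" "J' \<in> dyadic_cubes"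
  shows "shear i -` (I \<times> J) = shear i -` (I' \<times> J') \<longleftrightarrow> I = I' \<and> J = J'"
proof
  assume "shear i -` (I \<times> J) = shear i -` (I' \<times> J')"
  then have "I \<times> J = I' \<times> J'"
    by (metis surj_image_vimage_eq surj_shear)
  then show "I = I' \<and> J = J'"
    using assms[THEN dyadic_cube_nonempty] by (simp add: times_eq_iff)
qed simp

lemma shear_lebesgue:
  "shear i \<in> measurable lebesgue lborel"
  "distr lebesgue lborel (shear i) = (lborel :: ((real ^ 'n) \<times> (real ^ 'n)) measure)"
proof -
  have m: "shear i \<in> measurable lborel lborel" by simp
  show "shear i \<in> measurable lebesgue lborel" by (rule measurable_completion[OF m])
  have "distr lebesgue lborel (shear i) = distr lborel lborel (shear i)"
    by (rule distr_completion[OF m])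
  also have "\<dots> = distr lborel borel (shear i)" by (rule distr_cong) auto
  finally show "distr lebesgue lborel (shear i) = (lborel :: ((real ^ 'n) \<times> (real ^ 'n)) measure)"
    by (simp only: distr_shear)
qed

lemmas L2_inner_comp_shear = L2_inner_comp[OF shear_lebesgue]

lemma closed_subspace_all: "closed_subspace M (L2 M)"
  by (rule closed_subspaceI) (auto intro: L2_zero L2_add L2_scale)

lemma tube_family_orthonormal: "orthonormal lebesgue (tube_indices_of i) tube_family"
  unfolding orthonormal_def
proof (intro conjI ballI)
  fix p :: "nat \<times> ((real ^ 'n) \<times> (real ^ 'n)) set \<times> ('n \<Rightarrow> bool) \<times> ('n \<Rightarrow> bool)"
  assume "p \<in> tube_indices_of i"
  then obtain I J a b where p: "I \<in> dyadic_cubes" "J \<in> dyadic_cubes" "a \<in> signatures" "b \<in> signatures"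
    "p = (i, shear i -` (I \<times> J), a, b)"
    by (rule tube_indices_ofE)
  show "tube_family p \<in> L2 lebesgue"
    unfolding p(5) tube_family_eq[OF p(1,2)]
    by (rule L2_comp[OF shear_lebesgue]) (intro tensor_L2 haar_cube_L2 p)
  fix q :: "nat \<times> ((real ^ 'n) \<times> (real ^ 'n)) set \<times> ('n \<Rightarrow> bool) \<times> ('n \<Rightarrow> bool)"
  assume "q \<in> tube_indices_of i"
  then obtain I' J' a' b' where q: "I' \<in> dyadic_cubes" "J' \<in> dyadic_cubes" "a' \<in> signatures" "b' \<in> signatures"
    "q = (i, shear i -` (I' \<times> J'), a', b')"
    by (rule tube_indices_ofE)
  show "L2_inner lebesgue (tube_family p) (tube_family q) = of_bool (p = q)"
    unfolding p(5) q(5) tube_family_eq[OF p(1,2)] tube_family_eq[OF q(1,2)]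
    using p(1-4) q(1-4)
    by (simp add: L2_inner_comp_shear tensor_L2 haar_cube_L2 L2_inner_tensor haar_cube_L2_inner tube_eq_iff)
qed

text \<open>
  Pulled back along the shear, the claim becomes one about a closed subspace \<open>W\<close> that contains the
  products \<open>h_I^a \<otimes> h_J^b\<close>. With \<open>h_J^b\<close> fixed, the first factor can be replaced by the indicator of a cube; with
  that indicator fixed, so can the second.
\<close>

lemma tube_family_complete:
  "L2 lebesgue \<subseteq> expandable lebesgue (tube_indices_of i)
     (tube_family :: _ \<Rightarrow> (real ^ 'n) \<times> (real ^ 'n) \<Rightarrow> complex)"
  (is "_ \<subseteq> ?V")
proof (rule closed_subspace_completion)
  show V: "closed_subspace lebesgue ?V"
    by (rule closed_subspace_expandable[OF tube_family_orthonormal])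
  define W where "W = {f \<in> L2 lborel. f \<circ> shear i \<in> ?V}"
  have W: "closed_subspace lborel W"
    unfolding W_def by (rule closed_subspace_pullback[OF shear_lebesgue V])
  have gen: "tensor (complex_haar_cube a I) (complex_haar_cube b J) \<in> W"
    if "I \<in> dyadic_cubes" "J \<in> dyadic_cubes" "a \<in> signatures" "b \<in> signatures"
    for I J :: "(real ^ 'n) set" and a b
  proof -
    have "(i, shear i -` (I \<times> J), a, b) \<in> tube_indices_of i"
      using that by (auto simp: tube_indices_of_def tubes_def)
    from expandable_member[OF tube_family_orthonormal this] show ?thesis
      using that by (simp add: W_def tube_family_eq tensor_L2 haar_cube_L2)
  qed
  have half: "tensor (indicator I) (complex_haar_cube b J) \<in> W"
    if "I \<in> dyadic_cubes" "J \<in> dyadic_cubes" "b \<in> signatures" for I J :: "(real ^ 'n) set" and b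
  proof -
    have "indicator I \<in> {u \<in> L2 lborel. tensor u (complex_haar_cube b J) \<in> W}"
      by (rule closed_subspace_dyadic_cubes[OF closed_subspace_tensor_left[OF W]])
        (use that in \<open>auto simp: haar_cube_L2 gen\<close>)
    then show ?thesis by simp
  qed
  have ind: "(indicator I :: real ^ 'n \<Rightarrow> complex) \<in> L2 lborel" if "I \<in> dyadic_cubes" for I
    by (rule closed_subspace_dyadic_cubes[OF closed_subspace_all]) (auto simp: haar_cube_L2 that)
  have "tensor (indicator I) (indicator J) \<in> W"
    if "I \<in> dyadic_cubes" "J \<in> dyadic_cubes" for I J :: "(real ^ 'n) set"
  proof -
    have "indicator J \<in> {v \<in> L2 lborel. tensor (indicator I) v \<in> W}"
      by (rule closed_subspace_dyadic_cubes[OF closed_subspace_tensor_right[OF W]])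
        (use that in \<open>auto simp: haar_cube_L2 half ind\<close>)
    then show ?thesis by simp
  qed
  then have "L2 lborel \<subseteq> W"
    by (rule closed_subspace_dyadic_rectangles[OF W])
  then show "L2 lborel \<subseteq> ?V"
    using L2_comp_shear[of _ i] unfolding W_def by blast
qed

section \<open>The three bases together form a tight frame\<close>

theorem corollary2p2:
  "tight_frame_L2 (lebesgue :: ((real ^ 'n) \<times> (real ^ 'n)) measure) 3 tube_indices tube_family \<and>
   (\<forall>f \<in> L2 (lebesgue :: ((real ^ 'n) \<times> (real ^ 'n)) measure).
      \<exists>S. L2_has_sum lebesgue
            (\<lambda>j x. L2_inner lebesgue f (tube_family j) * tube_family j x) tube_indices S \<and>
          (AE x in lebesgue. f x = (1/3) * S x))"
proof -
  let ?J = "tube_indices_of :: nat \<Rightarrow> (nat \<times> ((real ^ 'n) \<times> (real ^ 'n)) set \<times> ('n \<Rightarrow> bool) \<times> ('n \<Rightarrow> bool)) set"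
  have split: "tube_indices = ?J 1 \<union> (?J 2 \<union> ?J 3)"
    by (auto simp: tube_indices_def tube_indices_of_def)
  have disj: "?J 2 \<inter> ?J 3 = {}" "?J 1 \<inter> (?J 2 \<union> ?J 3) = {}"
    by (auto simp: tube_indices_of_def)
  note exp = complete_orthonormal[OF tube_family_orthonormal tube_family_complete]
  have frame: "((\<lambda>j. (cmod (L2_inner lebesgue f (tube_family j)))\<^sup>2) has_sum 3 * (L2_norm lebesgue f)\<^sup>2)
      (tube_indices)" if f: "f \<in> L2 lebesgue" for f :: "(real ^ 'n) \<times> (real ^ 'n) \<Rightarrow> complex"
    using has_sum_Un_disjoint[OF exp(1)[OF f, of 1] has_sum_Un_disjoint[OF exp(1)[OF f, of 2] exp(1)[OF f, of 3] disj(1)] disj(2)]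
    by (simp add: split L2_norm_sq)
  have recon: "L2_has_sum lebesgue (\<lambda>j x. L2_inner lebesgue f (tube_family j) * tube_family j x) tube_indices
      (\<lambda>x. f x + (f x + f x))" if f: "f \<in> L2 lebesgue" for f :: "(real ^ 'n) \<times> (real ^ 'n) \<Rightarrow> complex"
    unfolding split
    by (intro L2_has_sum_Un_disjoint exp(2)[OF f] disj)
  have L2: "tube_family j \<in> L2 lebesgue" if "j \<in> tube_indices"
    for j :: "nat \<times> ((real ^ 'n) \<times> (real ^ 'n)) set \<times> ('n \<Rightarrow> bool) \<times> ('n \<Rightarrow> bool)"
    using that on_L2[OF tube_family_orthonormal] unfolding split by blast
  show ?thesis
  proof (intro conjI ballI)
    show "tight_frame_L2 (lebesgue :: ((real ^ 'n) \<times> (real ^ 'n)) measure) 3 tube_indices tube_family"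
      unfolding tight_frame_L2_def using frame L2 by simp
    fix f :: "(real ^ 'n) \<times> (real ^ 'n) \<Rightarrow> complex" assume "f \<in> L2 lebesgue"
    from recon[OF this] show "\<exists>S. L2_has_sum lebesgue
            (\<lambda>j x. L2_inner lebesgue f (tube_family j) * tube_family j x) tube_indices S \<and>
          (AE x in lebesgue. f x = (1/3) * S x)"
      by (intro exI[of _ "\<lambda>x. f x + (f x + f x)"]) auto
  qed
qed

end
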